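(* Let $K$ be a non-Archimedean local field of characteristic $p>0$ whose residue field has cardinality $q$, and let $f\in\mathcal{A}_K[1,1]$ be not special. Let $M$ be the number of zeroes (counted with multiplicity) of absolute value $1$ in $\Omega_K$ of the Laurent series $f(X)^q-f(X^q)$. Then $$\#\{\zeta\in\mu_\infty: f(\zeta)\in\mu_\infty\}\le M.$$
   Context: $\Omega_K$ is the completion of an algebraic closure of $K$ with respect to the extension of the absolute value $|\cdot|$ of $K$ (it is algebraically closed); $\mu_\infty$ is the group of roots of unity in $\Omega_K$. $\mathcal{A}_K[1,1]$ is the set of Laurent series $\sum_{n\in\mathbb{Z}}f_nX^n$ with $f_n\in K$ and $|f_n|\to0$ as $|n|\to\infty$. In characteristic $p$, $f$ is special if $f\in\overline{\mathbb{F}}_p[X,X^{-1}]$. *)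

theory Defs
  imports "HOL-Computational_Algebra.Polynomial"
begin

definition nonarch_abs :: "('a::field \<Rightarrow> real) \<Rightarrow> bool" where
  "nonarch_abs av \<longleftrightarrow>
     (\<forall>x. av x \<ge> 0) \<and> (\<forall>x. av x = 0 \<longleftrightarrow> x = 0) \<and>
     (\<forall>x y. av (x * y) = av x * av y) \<and>
     (\<forall>x y. av (x + y) \<le> max (av x) (av y))"

definition av_cauchy :: "('a::field \<Rightarrow> real) \<Rightarrow> (nat \<Rightarrow> 'a) \<Rightarrow> bool" where
  "av_cauchy av s \<longleftrightarrow> (\<forall>e>0. \<exists>N. \<forall>m\<ge>N. \<forall>n\<ge>N. av (s m - s n) < e)"

definition av_lim :: "('a::field \<Rightarrow> real) \<Rightarrow> (nat \<Rightarrow> 'a) \<Rightarrow> 'a \<Rightarrow> bool" where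
  "av_lim av s L \<longleftrightarrow> (\<forall>e>0. \<exists>N. \<forall>n\<ge>N. av (s n - L) < e)"

definition subfield_of :: "'a::field set \<Rightarrow> bool" where
  "subfield_of K \<longleftrightarrow> 0 \<in> K \<and> 1 \<in> K \<and> (\<forall>x\<in>K. \<forall>y\<in>K. x + y \<in> K \<and> x - y \<in> K \<and> x * y \<in> K)
     \<and> (\<forall>x\<in>K. inverse x \<in> K)"

definition algebraic_over :: "'a::field set \<Rightarrow> 'a \<Rightarrow> bool" where
  "algebraic_over K x \<longleftrightarrow> (\<exists>P. P \<noteq> 0 \<and> (\<forall>i. coeff P i \<in> K) \<and> poly P x = 0)"

definition local_field_char_p :: "('a::field \<Rightarrow> real) \<Rightarrow> 'a set \<Rightarrow> nat \<Rightarrow> nat \<Rightarrow> bool" where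
  "local_field_char_p av K p q \<longleftrightarrow>
     subfield_of K \<and> prime p \<and> of_nat p = (0::'a) \<and>
     (\<forall>s. (\<forall>n. s n \<in> K) \<and> av_cauchy av s \<longrightarrow> (\<exists>L\<in>K. av_lim av s L)) \<and>
     (\<exists>c::real. 0 < c \<and> c < 1 \<and> av ` (K - {0}) = range (\<lambda>n::int. c powi n)) \<and>
     (let OK = {x\<in>K. av x \<le> 1} in
        finite (OK // {(x, y). x \<in> OK \<and> y \<in> OK \<and> av (x - y) < 1}) \<and>
        card (OK // {(x, y). x \<in> OK \<and> y \<in> OK \<and> av (x - y) < 1}) = q)"

text \<open>('a, av) is Omega_K: complete, algebraically closed, and the algebraic closure of K
  inside it is dense (so 'a is the completion of an algebraic closure of K, with av extending
  the absolute value of K).\<close>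
definition is_Omega :: "('a::field \<Rightarrow> real) \<Rightarrow> 'a set \<Rightarrow> bool" where
  "is_Omega av K \<longleftrightarrow>
     (\<forall>s. av_cauchy av s \<longrightarrow> (\<exists>L. av_lim av s L)) \<and>
     (\<forall>P::'a poly. degree P > 0 \<longrightarrow> (\<exists>x. poly P x = 0)) \<and>
     (\<forall>x. \<forall>e>0. \<exists>y. algebraic_over K y \<and> av (x - y) < e)"

definition roots_of_unity :: "'a::field set" where
  "roots_of_unity = {x. \<exists>n>0. x ^ n = 1}"

definition lsum :: "('a::field \<Rightarrow> real) \<Rightarrow> (int \<Rightarrow> 'a) \<Rightarrow> 'a" where
  "lsum av s = (THE L. av_lim av (\<lambda>m. \<Sum>n\<in>{- int m..int m}. s n) L)"

definition coeffs_to_zero :: "('a::field \<Rightarrow> real) \<Rightarrow> (int \<Rightarrow> 'a) \<Rightarrow> bool" where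
  "coeffs_to_zero av f \<longleftrightarrow> (\<forall>e>0. \<exists>N. \<forall>n. N \<le> \<bar>n\<bar> \<longrightarrow> av (f n) < e)"

definition A11 :: "('a::field \<Rightarrow> real) \<Rightarrow> 'a set \<Rightarrow> (int \<Rightarrow> 'a) set" where
  "A11 av K = {f. (\<forall>n. f n \<in> K) \<and> coeffs_to_zero av f}"

definition ls_eval :: "('a::field \<Rightarrow> real) \<Rightarrow> (int \<Rightarrow> 'a) \<Rightarrow> 'a \<Rightarrow> 'a" where
  "ls_eval av f x = lsum av (\<lambda>n. f n * x powi n)"

definition ls_mult :: "('a::field \<Rightarrow> real) \<Rightarrow> (int \<Rightarrow> 'a) \<Rightarrow> (int \<Rightarrow> 'a) \<Rightarrow> (int \<Rightarrow> 'a)" where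
  "ls_mult av g h = (\<lambda>n. lsum av (\<lambda>m. g m * h (n - m)))"

primrec ls_pow :: "('a::field \<Rightarrow> real) \<Rightarrow> (int \<Rightarrow> 'a) \<Rightarrow> nat \<Rightarrow> (int \<Rightarrow> 'a)" where
  "ls_pow av g 0 = (\<lambda>n. if n = 0 then 1 else 0)"
| "ls_pow av g (Suc k) = ls_mult av g (ls_pow av g k)"

definition ls_subst_pow :: "(int \<Rightarrow> 'a::field) \<Rightarrow> nat \<Rightarrow> (int \<Rightarrow> 'a)" where
  "ls_subst_pow f q = (\<lambda>n. if int q dvd n then f (n div int q) else 0)"

definition zero_mult :: "('a::field \<Rightarrow> real) \<Rightarrow> (int \<Rightarrow> 'a) \<Rightarrow> 'a \<Rightarrow> nat" where
  "zero_mult av g z = Sup {m. \<exists>h. coeffs_to_zero av h \<and>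
      g = ls_mult av (ls_pow av (\<lambda>n. if n = 0 then - z else if n = 1 then 1 else 0) m) h}"

definition unit_zero_count :: "('a::field \<Rightarrow> real) \<Rightarrow> (int \<Rightarrow> 'a) \<Rightarrow> nat" where
  "unit_zero_count av g = (\<Sum>z\<in>{z. av z = 1 \<and> ls_eval av g z = 0}. zero_mult av g z)"

definition alg_prime_field :: "'a::field set" where
  "alg_prime_field = {x. \<exists>P. P \<noteq> 0 \<and> (\<forall>i. coeff P i \<in> range of_int) \<and> poly P x = 0}"

definition special :: "(int \<Rightarrow> 'a::field) \<Rightarrow> bool" where
  "special f \<longleftrightarrow> finite {n. f n \<noteq> 0} \<and> (\<forall>n. f n \<in> alg_prime_field)"

end

theory Submission
  imports Defs "HOL-Computational_Algebra.Primes"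
begin

text \<open>
  Let \<open>\<zeta>\<close> and \<open>\<eta> = f(\<zeta>)\<close> be roots of unity. The \<open>q\<close>-Frobenius of the maximal unramified
  extension of \<open>K\<close> fixes \<open>K\<close>, is an isometry and raises roots of unity to the power \<open>q\<close>, so it turns
  \<open>f(\<zeta>) = \<eta>\<close> into \<open>f(\<zeta>\<^sup>q) = \<eta>\<^sup>q\<close>. Hence \<open>\<zeta>\<close> is a zero of \<open>g = f(X)\<^sup>q - f(X\<^sup>q)\<close>. If \<open>g = 0\<close>,
  then every coefficient of \<open>f\<close> is fixed by \<open>q\<close>-Frobenius, hence zero or of absolute value one, and
  \<open>f\<close> is special. If \<open>g\<close> is nonzero, Strassmann's argument (dividing by \<open>X - z\<close> shortens the range of
  indices at which the Gauss norm is attained) shows that it has finitely many zeros on the unit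
  circle, and that their multiplicities are finite and positive.
\<close>

subsection \<open>Null families and their sums\<close>

locale complete_nonarch_field =
  fixes av :: "'a::field \<Rightarrow> real"
  assumes nonarch: "nonarch_abs av"
    and complete: "av_cauchy av s \<Longrightarrow> \<exists>L. av_lim av s L"
begin

section \<open>Ultrametric arithmetic of the absolute value\<close>

lemma av_nonneg [simp]: "0 \<le> av x"
  and av_eq_0_iff [simp]: "av x = 0 \<longleftrightarrow> x = 0"
  and av_mult [simp]: "av (x * y) = av x * av y"
  and av_add_le_max: "av (x + y) \<le> max (av x) (av y)"
  using nonarch by (auto simp: nonarch_abs_def)

lemma av_pos_iff [simp]: "0 < av x \<longleftrightarrow> x \<noteq> 0"
  using av_nonneg[of x] av_eq_0_iff[of x] by linarith

lemma av_0 [simp]: "av 0 = 0"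
  by simp

lemma av_1 [simp]: "av 1 = 1"
proof -
  have "av 1 * av 1 = av 1" by (simp flip: av_mult)
  then show ?thesis by simp
qed

lemma av_power [simp]: "av (x ^ n) = av x ^ n"
  by (induction n) auto

lemma av_minus [simp]: "av (- x) = av x"
proof -
  have "av (-1) ^ 2 = 1" by (simp flip: av_power)
  then have "av (-1) = 1"
    using av_nonneg[of "-1"] by (simp add: power2_eq_1_iff)
  then show ?thesis using av_mult[of "-1" x] by simp
qed

lemma av_inverse [simp]: "av (inverse x) = inverse (av x)"
proof (cases "x = 0")
  case False
  then have "av (inverse x) * av x = 1" by (simp flip: av_mult)
  then show ?thesis using False by (simp add: field_simps)
qed simp

lemma av_powi [simp]: "av (x powi n) = av x powi n"
  by (simp add: power_int_def)

lemma av_add_leI: "av x \<le> e \<Longrightarrow> av y \<le> e \<Longrightarrow> av (x + y) \<le> e"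
  using av_add_le_max[of x y] by linarith

lemma av_diff_leI: "av x \<le> e \<Longrightarrow> av y \<le> e \<Longrightarrow> av (x - y) \<le> e"
  using av_add_leI[of x e "- y"] by simp

lemma av_minus_commute: "av (x - y) = av (y - x)"
  using av_minus[of "x - y"] by simp

lemma av_diff_trans: "av (x - y) \<le> e \<Longrightarrow> av (y - z) \<le> e \<Longrightarrow> av (x - z) \<le> e"
  using av_add_leI[of "x - y" e "y - z"] by simp

lemma av_add_lessI: "av x < e \<Longrightarrow> av y < e \<Longrightarrow> av (x + y) < e"
  using av_add_le_max[of x y] by linarith

lemma av_diff_lessI: "av x < e \<Longrightarrow> av y < e \<Longrightarrow> av (x - y) < e"
  using av_add_lessI[of x e "- y"] by simp

text \<open>The isosceles principle: \<open>x = (x + y) - y\<close> keeps \<open>x + y\<close> from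
  being smaller than \<open>x\<close>.\<close>

lemma av_add_dominant:
  assumes "av y < av x"
  shows "av (x + y) = av x"
proof (rule antisym)
  show "av (x + y) \<le> av x" using av_add_leI assms by auto
  have "av x \<le> max (av (x + y)) (av y)" using av_add_le_max[of "x + y" "- y"] by simp
  then show "av x \<le> av (x + y)" using assms by linarith
qed

lemma av_sum_leI:
  assumes "0 \<le> e" and "\<And>i. i \<in> I \<Longrightarrow> av (s i) \<le> e"
  shows "av (sum s I) \<le> e"
  using assms
proof (induction I rule: infinite_finite_induct)
  case (insert i I)
  then show ?case by (simp add: av_add_leI)
qed auto

lemma eq_if_av_diff_le: "(\<And>e. 0 < e \<Longrightarrow> av (x - y) \<le> e) \<Longrightarrow> x = y"
  by (metis av_pos_iff dense eq_iff_diff_eq_0 leD)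

lemma av_eq_1_if_root_of_unity:
  assumes "x \<in> roots_of_unity"
  shows "av x = 1"
proof -
  obtain n where n: "n > 0" "x ^ n = 1" using assms by (auto simp: roots_of_unity_def)
  then have "av x ^ n = 1" by (simp flip: av_power)
  then show ?thesis using n power_eq_1_iff[of "av x" n] by simp
qed

lemma av_lim_unique:
  assumes "av_lim av s L" and "av_lim av s L'"
  shows "L = L'"
proof (rule eq_if_av_diff_le)
  fix e :: real assume "0 < e"
  then obtain N N' where "\<And>n. n \<ge> N \<Longrightarrow> av (s n - L) < e" "\<And>n. n \<ge> N' \<Longrightarrow> av (s n - L') < e"
    using assms unfolding av_lim_def by blast
  then have "av (s (max N N') - L) < e" "av (s (max N N') - L') < e" by auto
  then show "av (L - L') \<le> e"
    using av_diff_trans[of L "s (max N N')" e L'] by (simp add: av_minus_commute)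
qed

section \<open>Families tending to zero and their unconditional sums\<close>

abbreviation null :: "(int \<Rightarrow> 'a) \<Rightarrow> bool" where
  "null \<equiv> coeffs_to_zero av"

lemma null_finite:
  assumes "null s" "0 < e"
  shows "finite {n. e \<le> av (s n)}"
proof -
  obtain N where "\<And>n. N \<le> \<bar>n\<bar> \<Longrightarrow> av (s n) < e"
    using assms unfolding coeffs_to_zero_def by blast
  then have "\<bar>n\<bar> \<le> N" if "e \<le> av (s n)" for n using that by (meson linorder_le_cases not_le)
  then have "{n. e \<le> av (s n)} \<subseteq> {-N..N}" by (auto simp: abs_le_iff minus_le_iff)
  then show ?thesis using finite_subset by blast
qed

text \<open>Finite exceptional sets do not refer to the order of the integers, so this form survives
  reindexing and convolution. Halving \<open>e\<close> turns the non-strict bound into the strict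
  one.\<close>

lemma nullI:
  assumes "\<And>e. 0 < e \<Longrightarrow> \<exists>F. finite F \<and> (\<forall>n. n \<notin> F \<longrightarrow> av (s n) \<le> e)"
  shows "null s"
  unfolding coeffs_to_zero_def
proof (intro allI impI)
  fix e :: real assume "0 < e"
  then obtain F where F: "finite F" "\<And>n. n \<notin> F \<Longrightarrow> av (s n) \<le> e / 2" using assms[of "e / 2"] by auto
  define N where "N = Max (insert 0 (abs ` F)) + 1"
  have "n \<notin> F" if "N \<le> \<bar>n\<bar>" for n
  proof
    assume "n \<in> F"
    then have "\<bar>n\<bar> \<le> Max (insert 0 (abs ` F))" using F(1) by (intro Max_ge) auto
    then show False using that by (simp add: N_def)
  qed
  then show "\<exists>N. \<forall>n. N \<le> \<bar>n\<bar> \<longrightarrow> av (s n) < e"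
    using F(2) \<open>0 < e\<close> by (intro exI[of _ N]) fastforce
qed

lemma null_bound:
  assumes "null s"
  obtains B where "1 \<le> B" "\<And>n. av (s n) \<le> B"
proof -
  let ?A = "insert 1 ((\<lambda>n. av (s n)) ` {n. 1 \<le> av (s n)})"
  have fin: "finite ?A" using null_finite[OF assms, of 1] by simp
  have "av (s n) \<le> Max ?A" for n
  proof (cases "1 \<le> av (s n)")
    case True
    then show ?thesis using fin by (intro Max_ge) auto
  next
    case False
    then show ?thesis using Max_ge[OF fin, of 1] by simp
  qed
  moreover have "1 \<le> Max ?A" using Max_ge[OF fin, of 1] by simp
  ultimately show ?thesis using that by blast
qed

lemma null_finite_support: "finite {n. s n \<noteq> 0} \<Longrightarrow> null s"
  by (rule nullI) (rule exI[of _ "{n. s n \<noteq> 0}"], auto)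

lemma null_dominated:
  assumes "null s" "\<And>n. av (t n) \<le> C * av (s n)"
  shows "null t"
proof (rule nullI)
  fix e :: real assume "0 < e"
  define d where "d = e / (\<bar>C\<bar> + 1)"
  have d: "0 < d" "\<bar>C\<bar> * d \<le> e" using \<open>0 < e\<close> by (auto simp: d_def field_simps)
  have "av (t n) \<le> e" if "av (s n) < d" for n
  proof -
    have "av (t n) \<le> \<bar>C\<bar> * av (s n)"
      using assms(2)[of n] mult_right_mono[of C "\<bar>C\<bar>" "av (s n)"] by (meson abs_ge_self av_nonneg order_trans)
    also have "\<dots> \<le> \<bar>C\<bar> * d" using that by (intro mult_left_mono) auto
    finally show ?thesis using d by simp
  qed
  then show "\<exists>F. finite F \<and> (\<forall>n. n \<notin> F \<longrightarrow> av (t n) \<le> e)"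
    using null_finite[OF assms(1) d(1)] by (intro exI[of _ "{n. d \<le> av (s n)}"]) auto
qed

lemma null_add:
  assumes "null s" "null t"
  shows "null (\<lambda>n. s n + t n)"
proof (rule nullI)
  fix e :: real assume "0 < e"
  then show "\<exists>F. finite F \<and> (\<forall>n. n \<notin> F \<longrightarrow> av (s n + t n) \<le> e)"
    using null_finite[of s e] null_finite[of t e] assms
    by (intro exI[of _ "{n. e \<le> av (s n)} \<union> {n. e \<le> av (t n)}"]) (auto intro!: av_add_leI)
qed

lemma null_cmult: "null s \<Longrightarrow> null (\<lambda>n. c * s n)"
  by (erule null_dominated[where C = "av c"]) simp

lemma null_diff: "null s \<Longrightarrow> null t \<Longrightarrow> null (\<lambda>n. s n - t n)"
  using null_add[of s "\<lambda>n. -1 * t n"] null_cmult[of t "-1"] by simp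

text \<open>By the ultrametric inequality two partial sums differ by at most the largest term
  between them, so small terms already make the partial sums Cauchy.\<close>

lemma null_lim:
  assumes "null s"
  shows "av_lim av (\<lambda>m. \<Sum>n\<in>{- int m..int m}. s n) (lsum av s)"
proof -
  have "av_cauchy av (\<lambda>m. \<Sum>n\<in>{- int m..int m}. s n)"
    unfolding av_cauchy_def
  proof (intro allI impI)
    fix e :: real assume "0 < e"
    then obtain N where N: "\<And>n. N \<le> \<bar>n\<bar> \<Longrightarrow> av (s n) < e / 2"
      using assms unfolding coeffs_to_zero_def by (meson half_gt_zero)
    let ?S = "\<lambda>m. \<Sum>n\<in>{- int m..int m}. s n"
    have *: "av (?S n - ?S (nat N)) \<le> e / 2" if "nat N \<le> n" for n
    proof -
      have "?S n - ?S (nat N) = sum s ({- int n..int n} - {- int (nat N)..int (nat N)})"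
        using that by (subst sum_diff) auto
      also have "av \<dots> \<le> e / 2"
        using \<open>0 < e\<close> by (intro av_sum_leI less_imp_le N) (auto split: if_splits)
      finally show ?thesis .
    qed
    have "av (?S m - ?S n) < e" if "nat N \<le> m" "nat N \<le> n" for m n
      using av_diff_trans[of "?S m" "?S (nat N)" "e / 2" "?S n"] *[OF that(1)] *[OF that(2)] \<open>0 < e\<close>
      by (simp add: av_minus_commute)
    then show "\<exists>N. \<forall>m\<ge>N. \<forall>n\<ge>N. av (?S m - ?S n) < e" by blast
  qed
  from complete[OF this] obtain L where L: "av_lim av (\<lambda>m. \<Sum>n\<in>{- int m..int m}. s n) L" by blast
  then have "lsum av s = L" unfolding lsum_def by (intro the_equality) (auto dest: av_lim_unique)
  then show ?thesis using L by simp
qed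

text \<open>Compare both sides with a symmetric partial sum containing \<open>F\<close>. Since
  \<open>F\<close> is arbitrary, the sum does not depend on the symmetric order of summation;
  \<open>lsum_eqI\<close> below is the converse used to compute sums.\<close>

lemma lsum_approx:
  assumes "null s" "finite F" "0 < e" "\<And>n. n \<notin> F \<Longrightarrow> av (s n) \<le> e"
  shows "av (lsum av s - sum s F) \<le> e"
proof -
  let ?S = "\<lambda>m. \<Sum>n\<in>{- int m..int m}. s n"
  obtain N where N: "\<And>n. n \<ge> N \<Longrightarrow> av (?S n - lsum av s) < e"
    using null_lim[OF assms(1)] assms(3) unfolding av_lim_def by blast
  define m where "m = max N (nat (Max (insert 0 (abs ` F))))"
  have "F \<subseteq> {- int m..int m}"
  proof
    fix n assume "n \<in> F"
    then have "\<bar>n\<bar> \<le> Max (insert 0 (abs ` F))" using assms(2) by (intro Max_ge) auto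
    then show "n \<in> {- int m..int m}" unfolding m_def by auto
  qed
  then have "?S m - sum s F = sum s ({- int m..int m} - F)"
    by (subst sum_diff) auto
  also have "av \<dots> \<le> e" using assms by (intro av_sum_leI) auto
  finally have "av (?S m - sum s F) \<le> e" .
  moreover have "av (lsum av s - ?S m) \<le> e"
    using N[of m] by (simp add: m_def av_minus_commute less_imp_le)
  ultimately show ?thesis using av_diff_trans by blast
qed

lemma lsum_eqI:
  assumes "null s"
    and "\<And>e. 0 < e \<Longrightarrow> \<exists>F. finite F \<and> (\<forall>n. n \<notin> F \<longrightarrow> av (s n) \<le> e) \<and> av (sum s F - L) \<le> e"
  shows "lsum av s = L"
proof (rule eq_if_av_diff_le)
  fix e :: real assume "0 < e"
  then obtain F where F: "finite F" "\<And>n. n \<notin> F \<Longrightarrow> av (s n) \<le> e" "av (sum s F - L) \<le> e"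
    using assms(2) by blast
  show "av (lsum av s - L) \<le> e"
    using lsum_approx[OF assms(1) F(1) \<open>0 < e\<close> F(2)] F(3) by (rule av_diff_trans)
qed

lemma lsum_finite_support:
  assumes "finite F" "\<And>n. n \<notin> F \<Longrightarrow> s n = 0"
  shows "lsum av s = sum s F"
proof (rule lsum_eqI)
  have "{n. s n \<noteq> 0} \<subseteq> F" using assms by auto
  then show "null s" using assms finite_subset by (intro null_finite_support) blast
next
  fix e :: real assume "0 < e"
  then show "\<exists>F'. finite F' \<and> (\<forall>n. n \<notin> F' \<longrightarrow> av (s n) \<le> e) \<and> av (sum s F' - sum s F) \<le> e"
    using assms by (intro exI[of _ F]) simp
qed

lemma lsum_single: "(\<And>n. n \<noteq> k \<Longrightarrow> s n = 0) \<Longrightarrow> lsum av s = s k"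
  using lsum_finite_support[of "{k}" s] by simp

lemma lsum_le:
  assumes "null s" "0 < e" "\<And>n. av (s n) \<le> e"
  shows "av (lsum av s) \<le> e"
  using lsum_approx[of s "{}" e] assms by simp

lemma lsum_add:
  assumes "null s" "null t"
  shows "lsum av (\<lambda>n. s n + t n) = lsum av s + lsum av t"
proof (rule lsum_eqI[OF null_add[OF assms]])
  fix e :: real assume "0 < e"
  define F where "F = {n. e \<le> av (s n)} \<union> {n. e \<le> av (t n)}"
  have F: "finite F" "\<And>n. n \<notin> F \<Longrightarrow> av (s n) \<le> e" "\<And>n. n \<notin> F \<Longrightarrow> av (t n) \<le> e"
    using null_finite assms \<open>0 < e\<close> by (auto simp: F_def)
  have "av ((sum s F - lsum av s) + (sum t F - lsum av t)) \<le> e"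
    using lsum_approx[OF assms(1) F(1) \<open>0 < e\<close> F(2)] lsum_approx[OF assms(2) F(1) \<open>0 < e\<close> F(3)]
    by (intro av_add_leI) (simp_all add: av_minus_commute)
  then have "av ((\<Sum>n\<in>F. s n + t n) - (lsum av s + lsum av t)) \<le> e"
    by (simp add: sum.distrib algebra_simps)
  then show "\<exists>F. finite F \<and> (\<forall>n. n \<notin> F \<longrightarrow> av (s n + t n) \<le> e) \<and>
      av ((\<Sum>n\<in>F. s n + t n) - (lsum av s + lsum av t)) \<le> e"
    using F by (intro exI[of _ F]) (auto intro: av_add_leI)
qed

lemma lsum_cmult:
  assumes "null s"
  shows "lsum av (\<lambda>n. c * s n) = c * lsum av s"
proof (cases "c = 0")
  case True
  then show ?thesis using lsum_finite_support[of "{}" "\<lambda>_. 0"] by simp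
next
  case False
  show ?thesis
  proof (rule lsum_eqI[OF null_cmult[OF assms]])
    fix e :: real assume "0 < e"
    define d where "d = e / av c"
    have d: "0 < d" "av c * d = e" using False \<open>0 < e\<close> by (auto simp: d_def)
    define F where "F = {n. d \<le> av (s n)}"
    have F: "finite F" "\<And>n. n \<notin> F \<Longrightarrow> av (s n) \<le> d"
      using null_finite assms d by (auto simp: F_def)
    have "av c * av (sum s F - lsum av s) \<le> av c * d"
      using lsum_approx[OF assms F(1) d(1) F(2)] by (intro mult_left_mono) (auto simp: av_minus_commute)
    then have "av ((\<Sum>n\<in>F. c * s n) - c * lsum av s) \<le> e"
      unfolding sum_distrib_left[symmetric] right_diff_distrib[symmetric] using d by simp
    moreover have "av (c * s n) \<le> e" if "n \<notin> F" for n
      using mult_left_mono[OF F(2)[OF that], of "av c"] d by simp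
    ultimately show "\<exists>F. finite F \<and> (\<forall>n. n \<notin> F \<longrightarrow> av (c * s n) \<le> e) \<and>
      av ((\<Sum>n\<in>F. c * s n) - c * lsum av s) \<le> e" using F by blast
  qed
qed

lemma lsum_diff:
  assumes "null s" "null t"
  shows "lsum av (\<lambda>n. s n - t n) = lsum av s - lsum av t"
  using lsum_add[OF assms(1) null_cmult[OF assms(2), of "-1"]] lsum_cmult[OF assms(2), of "-1"]
  by simp

text \<open>This is the substitution of \<open>X ^ k\<close> for \<open>X\<close>. Multiplying a
  finite exceptional set by \<open>k\<close> gives one for the spread-out family with the same
  partial sum, which yields both claims.\<close>

lemma
  fixes k :: nat
  assumes "null s" "0 < k"
  shows null_dilate: "null (\<lambda>n. if int k dvd n then s (n div int k) else 0)" (is "null ?t")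
    and lsum_dilate: "lsum av (\<lambda>n. if int k dvd n then s (n div int k) else 0) = lsum av s"
proof -
  have *: "\<exists>F. finite F \<and> (\<forall>n. n \<notin> F \<longrightarrow> av (?t n) \<le> e) \<and> av (sum ?t F - lsum av s) \<le> e"
    if "0 < e" for e
  proof -
    define F where "F = {n. e \<le> av (s n)}"
    have F: "finite F" "\<And>n. n \<notin> F \<Longrightarrow> av (s n) \<le> e"
      using null_finite assms that by (auto simp: F_def)
    have "av (?t n) \<le> e" if n: "n \<notin> (\<lambda>n. int k * n) ` F" for n
    proof (cases "int k dvd n")
      case True
      then have "n div int k \<notin> F" using n by (auto simp: image_iff)
      then show ?thesis using True F by auto
    qed (use \<open>0 < e\<close> in auto)
    moreover have "sum ?t ((\<lambda>n. int k * n) ` F) = sum s F"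
      using assms(2) by (subst sum.reindex) (auto intro: inj_onI)
    ultimately show ?thesis
      using F lsum_approx[OF assms(1) F(1) that F(2)]
      by (intro exI[of _ "(\<lambda>n. int k * n) ` F"]) (auto simp: av_minus_commute)
  qed
  show "null ?t" by (rule nullI) (use * in blast)
  then show "lsum av ?t = lsum av s" using * by (rule lsum_eqI)
qed

lemma null_conv_term:
  assumes "null s" "null t"
  shows "null (\<lambda>m. s m * t (n - m))"
proof -
  obtain B where B: "\<And>n. av (t n) \<le> B" using null_bound[OF assms(2)] by blast
  show ?thesis
  proof (rule null_dominated[OF assms(1), where C = B])
    show "av (s m * t (n - m)) \<le> B * av (s m)" for m
      using mult_right_mono[OF B, of "av (s m)" "n - m"] by (simp add: mult.commute)
  qed
qed

text \<open>The Cauchy product. If \<open>s\<close> and \<open>t\<close> are at most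
  \<open>e / B\<close> outside \<open>F\<close>, a product of terms exceeds \<open>e\<close> only
  when both indices lie in \<open>F\<close>; up to \<open>e\<close> everything reduces to the finite
  double sum over \<open>F \<times> F\<close>.\<close>

lemma
  assumes "null s" "null t"
  shows null_conv: "null (ls_mult av s t)"
    and lsum_conv: "lsum av (ls_mult av s t) = lsum av s * lsum av t"
proof -
  obtain B1 where B1: "1 \<le> B1" "\<And>n. av (s n) \<le> B1" using null_bound[OF assms(1)] by blast
  obtain B2 where B2: "1 \<le> B2" "\<And>n. av (t n) \<le> B2" using null_bound[OF assms(2)] by blast
  define B where "B = max B1 B2"
  have B: "1 \<le> B" "\<And>n. av (s n) \<le> B" "\<And>n. av (t n) \<le> B"
    using B1 B2 by (auto simp: B_def le_max_iff_disj)
  have *: "\<exists>F. finite F \<and> (\<forall>n. n \<notin> F \<longrightarrow> av (ls_mult av s t n) \<le> e) \<and>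
     av (sum (ls_mult av s t) F - lsum av s * lsum av t) \<le> e"
    if "0 < e" for e
  proof -
    define d where "d = e / B"
    have d: "0 < d" "B * d = e" using \<open>0 < e\<close> B(1) by (auto simp: d_def)
    define F where "F = {n. d \<le> av (s n)} \<union> {n. d \<le> av (t n)}"
    have F: "finite F" "\<And>n. n \<notin> F \<Longrightarrow> av (s n) \<le> d" "\<And>n. n \<notin> F \<Longrightarrow> av (t n) \<le> d"
      using null_finite assms d(1) by (auto simp: F_def)
    have small: "av (s m) * av (t n) \<le> e" if "m \<notin> F \<or> n \<notin> F" for m n
    proof -
      have "av (s m) * av (t n) \<le> d * B \<or> av (s m) * av (t n) \<le> B * d"
        using that F B d by (auto intro!: mult_mono)
      then show ?thesis using d by (simp add: mult.commute)
    qed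
    \<comment> \<open>\<open>F'\<close> is the image of \<open>F \<times> F\<close> under addition,
      and \<open>E n\<close> parametrises the fibre over \<open>n\<close>.\<close>
    define E where "E = (\<lambda>n. {m \<in> F. n - m \<in> F})"
    define F' where "F' = (\<lambda>(m, n). m + n) ` (F \<times> F)"
    have E: "av (ls_mult av s t n - (\<Sum>m\<in>E n. s m * t (n - m))) \<le> e" for n
      unfolding ls_mult_def
    proof (rule lsum_approx)
      show "null (\<lambda>m. s m * t (n - m))" using assms by (rule null_conv_term)
    qed (use F(1) \<open>0 < e\<close> small in \<open>auto simp: E_def\<close>)
    have finF': "finite F'" using F(1) by (simp add: F'_def)
    have emp: "E n = {}" if "n \<notin> F'" for n
    proof (rule ccontr)
      assume "E n \<noteq> {}"
      then obtain m where "m \<in> F" "n - m \<in> F" by (auto simp: E_def)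
      then have "n \<in> F'" unfolding F'_def by (intro image_eqI[of _ _ "(m, n - m)"]) auto
      then show False using that by simp
    qed
    have "av (ls_mult av s t n) \<le> e" if "n \<notin> F'" for n
      using E[of n] emp[OF that] by simp
    moreover have "av (sum (ls_mult av s t) F' - lsum av s * lsum av t) \<le> e"
    proof -
      have "(\<Sum>n\<in>F'. \<Sum>m\<in>E n. s m * t (n - m)) = (\<Sum>(n, m)\<in>Sigma F' E. s m * t (n - m))"
        using F(1) by (subst sum.Sigma) (auto simp: finF' E_def)
      also have "\<dots> = (\<Sum>(m, n)\<in>F \<times> F. s m * t n)"
        by (rule sum.reindex_bij_witness[where i = "\<lambda>(m, n). (m + n, m)" and j = "\<lambda>(n, m). (m, n - m)"])
          (auto simp: E_def F'_def)
      also have "\<dots> = sum s F * sum t F"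
        by (simp add: sum_product sum.cartesian_product)
      finally have eq: "(\<Sum>n\<in>F'. \<Sum>m\<in>E n. s m * t (n - m)) = sum s F * sum t F" .
      have "av (\<Sum>n\<in>F'. ls_mult av s t n - (\<Sum>m\<in>E n. s m * t (n - m))) \<le> e"
        using E \<open>0 < e\<close> by (intro av_sum_leI) auto
      then have 1: "av (sum (ls_mult av s t) F' - sum s F * sum t F) \<le> e"
        by (simp add: sum_subtractf eq)
      \<comment> \<open>With finite sums \<open>S\<close>, \<open>T\<close> and limits
        \<open>s\<close>, \<open>t\<close>, the error is
        \<open>S T - s t = S (T - t) + (S - s) t\<close>, where each factor \<open>S\<close>,
        \<open>t\<close> is at most \<open>B\<close> and each difference at most
        \<open>d\<close>.\<close>
      have s: "av (lsum av s - sum s F) \<le> d" and t: "av (lsum av t - sum t F) \<le> d"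
        using lsum_approx[OF assms(1) F(1) d(1) F(2)] lsum_approx[OF assms(2) F(1) d(1) F(3)] by auto
      have bs: "av (sum s F) \<le> B" using B by (intro av_sum_leI) auto
      have bt: "av (lsum av t) \<le> B" using B assms by (intro lsum_le) auto
      have "av ((sum s F - lsum av s) * lsum av t) \<le> e"
        using mult_mono[OF s bt] d by (simp add: av_minus_commute mult.commute)
      moreover have "av (sum s F * (sum t F - lsum av t)) \<le> e"
        using mult_mono[OF bs t] d B(1) by (simp add: av_minus_commute)
      ultimately have "av (sum s F * (sum t F - lsum av t) + (sum s F - lsum av s) * lsum av t) \<le> e"
        by (intro av_add_leI)
      then have "av (sum s F * sum t F - lsum av s * lsum av t) \<le> e" by (simp add: algebra_simps)
      with 1 show ?thesis by (rule av_diff_trans)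
    qed
    ultimately show ?thesis using finF' by blast
  qed
  show "null (ls_mult av s t)" by (rule nullI) (use * in blast)
  then show "lsum av (ls_mult av s t) = lsum av s * lsum av t" using * by (rule lsum_eqI)
qed

subsection \<open>Evaluation on the unit circle\<close>

lemma null_twist:
  assumes "null s" "av x = 1"
  shows "null (\<lambda>n. s n * x powi n)"
  using assms(1) by (rule null_dominated[where C = 1]) (simp add: assms(2))

text \<open>Since \<open>x powi n = x powi m * x powi (n - m)\<close>, twisting by the powers of
  \<open>x\<close> commutes with convolution, and \<open>lsum_conv\<close> applies to the twisted
  families.\<close>

lemma ls_eval_mult:
  assumes "null s" "null t" "av x = 1"
  shows "ls_eval av (ls_mult av s t) x = ls_eval av s x * ls_eval av t x"
proof -
  have "x \<noteq> 0" using assms(3) by auto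
  have "ls_mult av s t n * x powi n = ls_mult av (\<lambda>n. s n * x powi n) (\<lambda>n. t n * x powi n) n" for n
  proof -
    have "x powi n = x powi m * x powi (n - m)" for m
      using power_int_add[of x m "n - m"] \<open>x \<noteq> 0\<close> by simp
    then have *: "s m * x powi m * (t (n - m) * x powi (n - m)) = x powi n * (s m * t (n - m))" for m
      by (simp add: ac_simps)
    show ?thesis
      unfolding ls_mult_def * lsum_cmult[OF null_conv_term[OF assms(1,2)]] by (rule mult.commute)
  qed
  then show ?thesis
    unfolding ls_eval_def using lsum_conv null_twist assms by simp
qed

lemma ls_eval_diff:
  assumes "null s" "null t" "av x = 1"
  shows "ls_eval av (\<lambda>n. s n - t n) x = ls_eval av s x - ls_eval av t x"
  unfolding ls_eval_def left_diff_distrib using assms by (intro lsum_diff null_twist)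

lemma null_ls_pow: "null s \<Longrightarrow> null (ls_pow av s k)"
  by (induction k) (simp_all add: null_conv null_finite_support)

lemma ls_eval_pow: "null s \<Longrightarrow> av x = 1 \<Longrightarrow> ls_eval av (ls_pow av s k) x = ls_eval av s x ^ k"
proof (induction k)
  case 0
  show ?case unfolding ls_eval_def ls_pow.simps by (subst lsum_single[where k = 0]) auto
qed (auto simp: ls_eval_mult null_ls_pow)

text \<open>The series \<open>X - z\<close>, written exactly as it occurs in
  \<open>zero_mult\<close>.\<close>

abbreviation lin :: "'a \<Rightarrow> int \<Rightarrow> 'a" where
  "lin z \<equiv> \<lambda>n. if n = 0 then - z else if n = 1 then 1 else 0"

lemma null_lin: "null (lin z)"
  by (rule null_finite_support) (rule finite_subset[of _ "{0, 1}"], auto)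

lemma ls_mult_lin: "ls_mult av (lin z) h n = h (n - 1) - z * h n"
  unfolding ls_mult_def by (subst lsum_finite_support[of "{0, 1}"]) auto

lemma ls_pow_1: "ls_pow av s 1 = s"
proof
  fix n
  show "ls_pow av s 1 n = s n"
    unfolding One_nat_def ls_pow.simps ls_mult_def by (subst lsum_single[where k = n]) auto
qed

subsection \<open>Zeros on the unit circle\<close>

text \<open>Both ends of the Newton polygon segment of slope zero: \<open>a\<close> and \<open>b\<close> are the first and last
  index at which the Gauss norm \<open>r\<close> is attained, so \<open>b - a\<close> counts the zeros of absolute
  value one.\<close>

definition profile :: "(int \<Rightarrow> 'a) \<Rightarrow> real \<Rightarrow> int \<Rightarrow> int \<Rightarrow> bool" where
  "profile s r a b \<longleftrightarrow> 0 < r \<and> (\<forall>n. av (s n) \<le> r) \<and> av (s a) = r \<and> av (s b) = r \<and>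
     (\<forall>n. n < a \<or> b < n \<longrightarrow> av (s n) < r)"

lemma profile_le: "profile s r a b \<Longrightarrow> a \<le> b"
  unfolding profile_def by (metis less_irrefl linorder_le_less_linear)

lemma profile_unique:
  assumes "profile s r a b" "profile s r' a' b'"
  shows "a = a'" "b = b'"
proof -
  have "r = r'" using assms unfolding profile_def by (metis antisym)
  then show "a = a'" "b = b'"
    using assms unfolding profile_def by (metis less_irrefl linorder_neqE)+
qed

text \<open>Only the finitely many terms at least as large as \<open>s k\<close> compete for the
  Gauss norm, so it is attained; as it is positive, it is attained only finitely often.\<close>

lemma profile_exists:
  assumes "null s" "s k \<noteq> 0"
  obtains r a b where "profile s r a b"
proof -
  define M where "M = {n. av (s k) \<le> av (s n)}"
  define r where "r = Max ((\<lambda>n. av (s n)) ` M)"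
  define A where "A = {n. r \<le> av (s n)}"
  have M: "finite M" "k \<in> M" using null_finite[OF assms(1), of "av (s k)"] assms(2) by (auto simp: M_def)
  have rk: "av (s k) \<le> r" unfolding r_def using M by (intro Max_ge) auto
  then have "0 < r" using assms(2) by (meson av_pos_iff less_le_trans)
  have le: "av (s n) \<le> r" for n
  proof (cases "n \<in> M")
    case True
    then show ?thesis unfolding r_def using M by (intro Max_ge) auto
  qed (use rk in \<open>auto simp: M_def\<close>)
  have "r \<in> (\<lambda>n. av (s n)) ` M" unfolding r_def using M by (intro Max_in) auto
  then have "A \<noteq> {}" by (auto simp: A_def)
  moreover have "finite A" unfolding A_def using assms(1) \<open>0 < r\<close> by (rule null_finite)
  ultimately have "Min A \<in> A" "Max A \<in> A" "\<And>n. n < Min A \<or> Max A < n \<Longrightarrow> n \<notin> A"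
    by (auto dest: Min_le Max_ge)
  then have "profile s r (Min A) (Max A)"
    unfolding profile_def using le \<open>0 < r\<close> by (auto simp: A_def not_le intro: antisym)
  then show thesis by (rule that)
qed

text \<open>The new coefficients are \<open>h (n - 1) - z * h n\<close>. At \<open>a\<close> the
  second term strictly dominates, at \<open>b + 1\<close> the first one does.\<close>

lemma profile_lin_mult:
  assumes h: "profile h r a b" and z: "av z = 1"
  shows "profile (ls_mult av (lin z) h) r a (b + 1)"
proof -
  have *: "0 < r" "\<And>n. av (h n) \<le> r" "av (h a) = r" "av (h b) = r"
    "\<And>n. n < a \<Longrightarrow> av (h n) < r" "\<And>n. b < n \<Longrightarrow> av (h n) < r"
    using h by (auto simp: profile_def)
  have zh: "av (z * h n) = av (h n)" for n using z by simp
  have a: "av (h (a - 1) - z * h a) = r"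
    using av_add_dominant[of "h (a - 1)" "- (z * h a)"] *(3) *(5)[of "a - 1"] z by simp
  have b: "av (h b - z * h (b + 1)) = r"
    using av_add_dominant[of "- (z * h (b + 1))" "h b"] *(4) *(6)[of "b + 1"] z by simp
  show ?thesis
    unfolding profile_def ls_mult_lin
  proof (intro conjI allI impI)
    show "av (h (n - 1) - z * h n) \<le> r" for n by (intro av_diff_leI) (simp_all add: * z)
    show "av (h (n - 1) - z * h n) < r" if "n < a \<or> b + 1 < n" for n
      using that by (intro av_diff_lessI) (auto simp: * z)
  qed (use a b *(1) in simp_all)
qed

text \<open>The recursion \<open>s k = h (k - 1) - z * h k\<close> is solved by the tail sums
  \<open>h k\<close> over \<open>j > k\<close>. This form gives decay for \<open>k\<close> towards
  plus infinity; the zero at \<open>z\<close> rewrites \<open>h k\<close> as minus the complementary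
  sum, which gives decay at the other end.\<close>

lemma exists_linear_factor:
  assumes s: "null s" and z: "av z = 1" and zero: "ls_eval av s z = 0"
  obtains h where "null h" "s = ls_mult av (lin z) h"
proof -
  have "z \<noteq> 0" using z by auto
  define u where "u = (\<lambda>k j. if k < j then z powi (j - k - 1) * s j else 0)"
  define v where "v = (\<lambda>k j. if j \<le> k then z powi (j - k - 1) * s j else 0)"
  define h where "h = (\<lambda>k. lsum av (u k))"
  have nu: "null (u k)" and nv: "null (v k)" for k
    by (rule null_dominated[OF s, where C = 1]; simp add: u_def v_def z)+
  \<comment> \<open>The two halves add up to \<open>z powi (- k - 1)\<close> times the value of
    \<open>s\<close> at \<open>z\<close>.\<close>
  have "h k = - lsum av (v k)" for k
  proof -
    have "lsum av (u k) + lsum av (v k) = lsum av (\<lambda>j. z powi (- k - 1) * (s j * z powi j))"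
      unfolding lsum_add[OF nu nv, symmetric]
    proof (rule arg_cong[of _ _ "lsum av"], rule ext)
      fix j
      have "z powi (j - k - 1) = z powi (- k - 1) * z powi j"
        using power_int_add[of z "- k - 1" j] \<open>z \<noteq> 0\<close> by (simp add: algebra_simps)
      then show "u k j + v k j = z powi (- k - 1) * (s j * z powi j)" by (simp add: u_def v_def)
    qed
    also have "\<dots> = 0"
      using lsum_cmult[OF null_twist[OF s z]] zero by (simp add: ls_eval_def)
    finally show ?thesis by (simp add: h_def eq_neg_iff_add_eq_0)
  qed
  have "null h"
  proof (rule nullI)
    fix e :: real assume "0 < e"
    then obtain N where N: "\<And>n. N \<le> \<bar>n\<bar> \<Longrightarrow> av (s n) < e"
      using s unfolding coeffs_to_zero_def by blast
    have "av (h k) \<le> e" if "k \<notin> {- \<bar>N\<bar>..\<bar>N\<bar>}" for k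
    proof (cases "\<bar>N\<bar> < k")
      case True
      have "av (lsum av (u k)) \<le> e"
      proof (rule lsum_le[OF nu \<open>0 < e\<close>])
        show "av (u k j) \<le> e" for j
          using True N[of j] \<open>0 < e\<close> by (cases "k < j") (simp_all add: u_def z less_imp_le)
      qed
      then show ?thesis by (simp add: h_def)
    next
      case False
      have "av (lsum av (v k)) \<le> e"
      proof (rule lsum_le[OF nv \<open>0 < e\<close>])
        show "av (v k j) \<le> e" for j
          using that False N[of j] \<open>0 < e\<close> by (cases "j \<le> k") (simp_all add: v_def z less_imp_le)
      qed
      then show ?thesis using \<open>h k = - lsum av (v k)\<close> by simp
    qed
    then show "\<exists>F. finite F \<and> (\<forall>n. n \<notin> F \<longrightarrow> av (h n) \<le> e)" by blast
  qed
  moreover have "s = ls_mult av (lin z) h"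
  proof
    fix k
    have "h (k - 1) - z * h k = lsum av (\<lambda>j. u (k - 1) j - z * u k j)"
      unfolding h_def by (simp add: lsum_diff lsum_cmult null_cmult nu)
    also have "\<dots> = u (k - 1) k - z * u k k"
    proof (rule lsum_single)
      fix j assume "j \<noteq> k"
      have "z powi (j - k) = z * z powi (j - k - 1)"
        using power_int_add[of z 1 "j - k - 1"] \<open>z \<noteq> 0\<close> by simp
      then show "u (k - 1) j - z * u k j = 0" using \<open>j \<noteq> k\<close> by (auto simp: u_def)
    qed
    finally show "s k = ls_mult av (lin z) h k" by (simp add: ls_mult_lin u_def)
  qed
  ultimately show thesis by (rule that)
qed

lemma ls_eval_lin: "av x = 1 \<Longrightarrow> ls_eval av (lin z) x = x - z"
  unfolding ls_eval_def by (subst lsum_finite_support[of "{0, 1}"]) auto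

text \<open>Induction on \<open>b - a\<close>. Splitting off a zero \<open>z\<close> leaves a
  cofactor with profile from \<open>a\<close> to \<open>b - 1\<close>, and every other zero of
  \<open>s\<close> is a zero of the cofactor.\<close>

lemma finite_unit_zeros:
  assumes "null s" "profile s r a b"
  shows "finite {x. av x = 1 \<and> ls_eval av s x = 0}"
  using assms
proof (induction "nat (b - a)" arbitrary: s r a b rule: less_induct)
  case less
  show ?case
  proof (cases "{x. av x = 1 \<and> ls_eval av s x = 0} = {}")
    case False
    then obtain z where z: "av z = 1" "ls_eval av s z = 0" by auto
    with less.prems obtain h where h: "null h" "s = ls_mult av (lin z) h"
      using exists_linear_factor by blast
    have "\<exists>k. h k \<noteq> 0"
    proof (rule ccontr)
      assume "\<nexists>k. h k \<noteq> 0"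
      then have "s a = 0" by (simp add: h(2) ls_mult_lin)
      then show False using less.prems(2) by (auto simp: profile_def)
    qed
    then obtain r' a' b' where h': "profile h r' a' b'" using profile_exists[OF h(1)] by blast
    then have "a = a'" "b = b' + 1"
      using profile_unique[OF less.prems(2)] profile_lin_mult[OF h' z(1)] h(2) by auto
    then have "finite {x. av x = 1 \<and> ls_eval av h x = 0}"
      using less.hyps[OF _ h(1) h'] profile_le[OF h'] by simp
    moreover have "{x. av x = 1 \<and> ls_eval av s x = 0} \<subseteq> insert z {x. av x = 1 \<and> ls_eval av h x = 0}"
      unfolding h(2) using h(1) null_lin[of z] by (auto simp: ls_eval_mult ls_eval_lin)
    ultimately show ?thesis using finite_subset by blast
  next
    case True
    then show ?thesis by (simp only: finite.emptyI)
  qed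
qed

text \<open>An identity theorem: a nonzero difference would have only finitely many zeros on the
  unit circle. It allows identities of series to be checked on values, where no multiple sums
  occur.\<close>

lemma ls_eqI:
  assumes "null s" "null t" "infinite {x. av x = 1}"
    and "\<And>x. av x = 1 \<Longrightarrow> ls_eval av s x = ls_eval av t x"
  shows "s = t"
proof (rule ccontr)
  assume "s \<noteq> t"
  then obtain k where "s k - t k \<noteq> 0" by auto
  then obtain r a b where "profile (\<lambda>n. s n - t n) r a b"
    using profile_exists[OF null_diff[OF assms(1,2)]] by blast
  from finite_unit_zeros[OF null_diff[OF assms(1,2)] this] show False
    using assms by (simp add: ls_eval_diff cong: conj_cong)
qed

lemma profile_lin_pow_mult:
  assumes "null h" "profile h r a b" "av z = 1" "infinite {x. av x = 1}"
  shows "profile (ls_mult av (ls_pow av (lin z) m) h) r a (b + int m)"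
proof (induction m)
  case 0
  have "ls_mult av (ls_pow av (lin z) 0) h = h"
    by (rule ext) (simp add: ls_mult_def, subst lsum_single[where k = 0], auto)
  then show ?case using assms by simp
next
  case (Suc m)
  \<comment> \<open>Associativity of convolution is obtained here by evaluating both sides.\<close>
  have "ls_mult av (ls_pow av (lin z) (Suc m)) h =
    ls_mult av (lin z) (ls_mult av (ls_pow av (lin z) m) h)"
    using assms by (intro ls_eqI)
      (simp_all add: ls_eval_mult ls_eval_pow null_conv null_lin null_ls_pow del: ls_pow.simps(2))
  then show ?case using profile_lin_mult[OF Suc.IH assms(3)] by (simp add: ac_simps)
qed

text \<open>A \<open>Sup\<close> of natural numbers is informative only for a bounded set. The bound
  is \<open>b - a\<close>, as each factor \<open>X - z\<close> lengthens the profile by one; a zero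
  at \<open>z\<close> puts 1 into the set.\<close>

lemma zero_mult_pos:
  assumes s: "null s" "profile s r a b" and z: "av z = 1" "ls_eval av s z = 0"
    and inf: "infinite {x. av x = 1}"
  shows "1 \<le> zero_mult av s z"
proof -
  let ?M = "{m. \<exists>h. null h \<and> s = ls_mult av (ls_pow av (lin z) m) h}"
  have "m \<le> nat (b - a)" if "m \<in> ?M" for m
  proof -
    obtain h where h: "null h" "s = ls_mult av (ls_pow av (lin z) m) h" using \<open>m \<in> ?M\<close> by blast
    have "\<exists>k. h k \<noteq> 0"
    proof (rule ccontr)
      assume "\<nexists>k. h k \<noteq> 0"
      then have "s a = 0" using lsum_single[of 0 "\<lambda>_. 0"] by (simp add: h(2) ls_mult_def)
      then show False using s(2) by (auto simp: profile_def)
    qed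
    then obtain r' a' b' where h': "profile h r' a' b'" using profile_exists[OF h(1)] by blast
    then have "a = a'" "b = b' + int m"
      using profile_unique[OF s(2)] profile_lin_pow_mult[OF h(1) h' z(1) inf, of m] h(2) by auto
    then show ?thesis using profile_le[OF h'] by simp
  qed
  then have "bdd_above ?M" by (meson bdd_above.I)
  moreover have "1 \<in> ?M"
  proof -
    obtain h where "null h" "s = ls_mult av (lin z) h" using exists_linear_factor[OF s(1) z] .
    then show ?thesis unfolding mem_Collect_eq ls_pow_1 by (intro exI conjI)
  qed
  ultimately show ?thesis unfolding zero_mult_def by (intro cSup_upper)
qed

text \<open>Supplies the infinitude required by \<open>ls_eqI\<close>, through the points
  \<open>1 + t ^ Suc i\<close>.\<close>

lemma infinite_unit_circle:
  assumes "0 < av t" "av t < 1"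
  shows "infinite {x. av x = 1}"
proof -
  have "inj (\<lambda>i. 1 + t ^ Suc i)"
  proof (rule injI)
    fix i j assume "1 + t ^ Suc i = 1 + t ^ Suc j"
    then have "t ^ Suc i = t ^ Suc j" by simp
    then have "av t ^ Suc i = av t ^ Suc j" by (metis av_power)
    then show "i = j" using assms power_inject_exp'[of "av t" "Suc i" "Suc j"] by simp
  qed
  moreover have "range (\<lambda>i. 1 + t ^ Suc i) \<subseteq> {x. av x = 1}"
  proof clarify
    fix i
    have "av t ^ Suc i < 1" using assms by (intro power_Suc_less_one) auto
    then show "av (1 + t ^ Suc i) = 1" using av_add_dominant[of "t ^ Suc i" 1] by simp
  qed
  ultimately show ?thesis using range_inj_infinite infinite_super by blast
qed

end

subsection \<open>Frobenius and Teichmueller representatives\<close>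

locale char_p_local_field = complete_nonarch_field av
  for av :: "'a::field \<Rightarrow> real" +
  fixes K :: "'a set" and p q :: nat
  assumes local: "local_field_char_p av K p q"
begin

lemma K_0 [simp]: "0 \<in> K" and K_1 [simp]: "1 \<in> K"
  and K_add: "x \<in> K \<Longrightarrow> y \<in> K \<Longrightarrow> x + y \<in> K"
  and K_diff: "x \<in> K \<Longrightarrow> y \<in> K \<Longrightarrow> x - y \<in> K"
  and K_mult: "x \<in> K \<Longrightarrow> y \<in> K \<Longrightarrow> x * y \<in> K"
  and K_inverse: "x \<in> K \<Longrightarrow> inverse x \<in> K"
  and prime_p: "prime p" and of_nat_p: "of_nat p = (0::'a)"
  using local by (auto simp: local_field_char_p_def subfield_of_def)

lemma K_divide: "x \<in> K \<Longrightarrow> y \<in> K \<Longrightarrow> x / y \<in> K"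
  by (simp add: divide_inverse K_mult K_inverse)

lemma K_power: "x \<in> K \<Longrightarrow> x ^ n \<in> K"
  by (induction n) (auto intro: K_mult)

lemma K_complete:
  assumes "\<And>n. s n \<in> K" "av_cauchy av s"
  obtains L where "L \<in> K" "av_lim av s L"
  using local assms unfolding local_field_char_p_def by blast

text \<open>The value group is generated by some \<open>c < 1\<close>, so \<open>c\<close> is the
  largest value below one. This gap improves \<open>< 1\<close> to \<open>\<le> av t\<close> and
  drives the induction in \<open>frobenius_isometry\<close>.\<close>

lemma uniformizer:
  obtains t where "t \<in> K" "0 < av t" "av t < 1" "\<And>x. x \<in> K \<Longrightarrow> av x < 1 \<Longrightarrow> av x \<le> av t"
proof -
  obtain c :: real where c: "0 < c" "c < 1" "av ` (K - {0}) = range (\<lambda>n::int. c powi n)"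
    using local unfolding local_field_char_p_def by blast
  have "c powi 1 \<in> av ` (K - {0})" unfolding c(3) by (rule rangeI)
  then obtain t where t: "t \<in> K" "av t = c" by auto
  have "av x \<le> c" if "x \<in> K" "av x < 1" for x
  proof (cases "x = 0")
    case False
    then have "av x \<in> range (\<lambda>n::int. c powi n)" using that c(3) by blast
    then obtain n where n: "av x = c powi n" by auto
    have "1 \<le> n"
    proof (rule ccontr)
      assume "\<not> 1 \<le> n"
      then have "c powi n = inverse c ^ nat (- n)" by (cases "n = 0") (auto simp: power_int_def)
      moreover have "1 \<le> inverse c ^ nat (- n)"
        using c by (intro one_le_power) (simp add: one_le_inverse_iff)
      ultimately show False using n that by simp
    qed
    then have "c powi n = c ^ nat n" by (simp add: power_int_def)
    also have "\<dots> \<le> c ^ 1" using \<open>1 \<le> n\<close> c by (intro power_decreasing) auto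
    finally show ?thesis using n by simp
  qed (use c in simp)
  then show thesis using that[of t] t c by simp
qed

lemma CHAR_p: "CHAR('a) = p"
proof -
  have "CHAR('a) dvd p" using of_nat_p by (simp add: of_nat_eq_0_iff_char_dvd)
  then show ?thesis using prime_p CHAR_not_1' by (metis One_nat_def prime_nat_iff)
qed

lemma frobenius_add: "(x + y :: 'a) ^ (p ^ n) = x ^ (p ^ n) + y ^ (p ^ n)"
  using freshmans_dream'[where ?'a = 'a] prime_p by (simp add: CHAR_p)

lemma frobenius_diff: "(x - y :: 'a) ^ (p ^ n) = x ^ (p ^ n) - y ^ (p ^ n)"
  using frobenius_add[of "x - y" y n] by simp

lemma frobenius_inj:
  assumes "x ^ (p ^ n) = (y :: 'a) ^ (p ^ n)"
  shows "x = y"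
proof -
  have "(x - y) ^ (p ^ n) = 0" using assms by (simp add: frobenius_diff)
  then show ?thesis by simp
qed

text \<open>The algebraic closure of the prime field, as the elements periodic under Frobenius.\<close>

definition Fbar :: "'a set" where
  "Fbar = {y. \<exists>d>0. y ^ (p ^ d) = y}"

lemma FbarI: "0 < d \<Longrightarrow> y ^ (p ^ d) = y \<Longrightarrow> y \<in> Fbar"
  by (auto simp: Fbar_def)

lemma frobenius_iterate:
  fixes y :: 'a
  assumes "y ^ (p ^ d) = y"
  shows "y ^ (p ^ (d * k)) = y"
proof (induction k)
  case (Suc k)
  have "y ^ (p ^ (d * Suc k)) = (y ^ (p ^ d)) ^ (p ^ (d * k))"
    by (simp add: power_add flip: power_mult)
  then show ?case using assms Suc by simp
qed simp

text \<open>The product of two periods is a common one, so closure of \<open>Fbar\<close> under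
  field operations follows from a single power of Frobenius being additive and
  multiplicative.\<close>

lemma Fbar_common_period:
  assumes "x \<in> Fbar" "y \<in> Fbar"
  obtains d where "d > 0" "x ^ (p ^ d) = x" "y ^ (p ^ d) = y"
proof -
  obtain a b where "a > 0" "b > 0" "x ^ (p ^ a) = x" "y ^ (p ^ b) = y"
    using assms by (auto simp: Fbar_def)
  then show thesis
    using that[of "a * b"] frobenius_iterate[of x a b] frobenius_iterate[of y b a]
    by (simp add: mult.commute)
qed

lemma Fbar_add: "x \<in> Fbar \<Longrightarrow> y \<in> Fbar \<Longrightarrow> x + y \<in> Fbar"
  by (rule Fbar_common_period[of x y], assumption+, erule FbarI) (simp add: frobenius_add)

lemma Fbar_diff: "x \<in> Fbar \<Longrightarrow> y \<in> Fbar \<Longrightarrow> x - y \<in> Fbar"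
  by (rule Fbar_common_period[of x y], assumption+, erule FbarI) (simp add: frobenius_diff)

lemma Fbar_mult: "x \<in> Fbar \<Longrightarrow> y \<in> Fbar \<Longrightarrow> x * y \<in> Fbar"
  by (rule Fbar_common_period[of x y], assumption+, erule FbarI) (simp add: power_mult_distrib)

lemma Fbar_0 [simp]: "0 \<in> Fbar" and Fbar_1 [simp]: "1 \<in> Fbar"
  using prime_gt_0_nat[OF prime_p] by (auto intro: FbarI[of 1])

lemma Fbar_sum: "(\<And>i. i \<in> I \<Longrightarrow> g i \<in> Fbar) \<Longrightarrow> sum g I \<in> Fbar"
  by (induction I rule: infinite_finite_induct) (auto intro: Fbar_add)

lemma root_of_unity_if_power_eq_self:
  fixes x :: 'a
  assumes "x ^ n = x" "x \<noteq> 0" "1 < n"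
  shows "x \<in> roots_of_unity"
proof -
  have "x ^ (n - 1) * x = x" using assms power_minus_mult[of n x] by simp
  then have "x ^ (n - 1) = 1" using assms(2) by simp
  then show ?thesis using assms(3) by (auto simp: roots_of_unity_def intro!: exI[of _ "n - 1"])
qed

lemma Fbar_av:
  assumes "x \<in> Fbar" "x \<noteq> 0"
  shows "av x = 1"
proof -
  obtain d where d: "d > 0" "x ^ (p ^ d) = x" using assms by (auto simp: Fbar_def)
  have "1 < p ^ d" using prime_gt_1_nat[OF prime_p] d by (intro one_less_power)
  then show ?thesis
    using d(2) assms(2) av_eq_1_if_root_of_unity root_of_unity_if_power_eq_self by blast
qed

text \<open>Pigeonhole: \<open>x\<close> has finitely many powers, so two Frobenius iterates
  coincide, and injectivity of Frobenius cancels the smaller exponent.\<close>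

lemma roots_of_unity_Fbar:
  assumes "x \<in> roots_of_unity"
  shows "x \<in> Fbar"
proof -
  obtain n where n: "n > 0" "x ^ n = 1" using assms by (auto simp: roots_of_unity_def)
  have "x ^ k = x ^ (k mod n)" for k
  proof -
    have "x ^ k = x ^ (n * (k div n) + k mod n)" by simp
    also have "\<dots> = x ^ (k mod n)" unfolding power_add power_mult n(2) by simp
    finally show ?thesis .
  qed
  then have "x ^ k \<in> (\<lambda>j. x ^ j) ` {..<n}" for k
    using n(1) by (metis imageI lessThan_iff mod_less_divisor)
  then have "range (\<lambda>k. x ^ (p ^ k)) \<subseteq> (\<lambda>j. x ^ j) ` {..<n}" by blast
  then have "finite (range (\<lambda>k. x ^ (p ^ k)))" by (rule finite_subset) simp
  then have "\<not> inj (\<lambda>k. x ^ (p ^ k))" using range_inj_infinite by blast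
  then obtain i j where ij: "i < j" "x ^ (p ^ i) = x ^ (p ^ j)"
    unfolding inj_def by (metis linorder_neqE_nat)
  have "x ^ (p ^ j) = (x ^ (p ^ (j - i))) ^ (p ^ i)"
    using ij(1) by (simp flip: power_mult power_add)
  then have "x = x ^ (p ^ (j - i))" using ij(2) frobenius_inj[of x i] by simp
  then show ?thesis using ij(1) unfolding Fbar_def by (auto intro!: exI[of _ "j - i"])
qed

section \<open>The residue field and the constant field of \<open>K\<close>\<close>

definition OK :: "'a set" where
  "OK = {x \<in> K. av x \<le> 1}"

definition residue_rel :: "('a \<times> 'a) set" where
  "residue_rel = {(x, y). x \<in> OK \<and> y \<in> OK \<and> av (x - y) < 1}"

lemma finite_residue: "finite (OK // residue_rel)"
  and card_residue: "card (OK // residue_rel) = q"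
  using local unfolding local_field_char_p_def OK_def residue_rel_def Let_def by auto

lemma equiv_residue: "equiv OK residue_rel"
proof (rule equivI)
  show "refl_on OK residue_rel" by (auto simp: refl_on_def residue_rel_def)
  show "sym residue_rel" by (auto simp: sym_def residue_rel_def av_minus_commute)
  show "trans residue_rel"
  proof (rule transI)
    fix x y z assume "(x, y) \<in> residue_rel" "(y, z) \<in> residue_rel"
    then show "(x, z) \<in> residue_rel"
      using av_add_lessI[of "x - y" 1 "y - z"] by (auto simp: residue_rel_def)
  qed
qed (auto simp: residue_rel_def)

text \<open>Pigeonhole in the finite residue field makes two Frobenius iterates of \<open>a\<close>
  congruent. Their difference is a \<open>p ^ i\<close>-th power, and a power of absolute value
  below one has a base of absolute value below one.\<close>

lemma frobenius_almost_periodic: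
  assumes "a \<in> OK"
  obtains d where "d > 0" "av (a ^ (p ^ d) - a) < 1"
proof -
  have OK: "a ^ (p ^ k) \<in> OK" for k
    using assms by (auto simp: OK_def K_power power_le_one)
  then have "residue_rel `` {a ^ (p ^ k)} \<in> OK // residue_rel" for k by (rule quotientI)
  then have "finite (range (\<lambda>k. residue_rel `` {a ^ (p ^ k)}))"
    by (blast intro: finite_subset[OF _ finite_residue])
  then have "\<not> inj (\<lambda>k. residue_rel `` {a ^ (p ^ k)})" using range_inj_infinite by blast
  then obtain i j where ij: "i < j" "residue_rel `` {a ^ (p ^ i)} = residue_rel `` {a ^ (p ^ j)}"
    unfolding inj_def by (metis linorder_neqE_nat)
  then have "(a ^ (p ^ i), a ^ (p ^ j)) \<in> residue_rel"
    using eq_equiv_class[OF _ equiv_residue OK] by blast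
  moreover have "a ^ (p ^ j) = (a ^ (p ^ (j - i))) ^ (p ^ i)"
    using ij(1) by (simp flip: power_mult power_add)
  ultimately have "av ((a ^ (p ^ (j - i)) - a) ^ (p ^ i)) < 1"
    by (simp add: residue_rel_def frobenius_diff av_minus_commute)
  then have "av (a ^ (p ^ (j - i)) - a) < 1"
    using one_le_power[of "av (a ^ (p ^ (j - i)) - a)" "p ^ i"] by (simp add: not_le[symmetric]) blast
  then show thesis using that[of "j - i"] ij(1) by simp
qed

text \<open>The Teichmueller representative of \<open>a\<close> is the limit of the iterated powers
  \<open>a ^ (p ^ (d * k))\<close>, where \<open>d\<close> is a Frobenius period of the residue class.\<close>

lemma teichmueller:
  assumes "a \<in> OK"
  obtains b where "b \<in> K" "b \<in> Fbar" "av (a - b) < 1"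
proof -
  obtain d where d: "d > 0" "av (a ^ (p ^ d) - a) < 1"
    using frobenius_almost_periodic[OF assms] .
  define \<delta> where "\<delta> = av (a ^ (p ^ d) - a)"
  have \<delta>: "0 \<le> \<delta>" "\<delta> < 1" using d by (simp_all add: \<delta>_def)
  define u where "u = (\<lambda>k. a ^ (p ^ (d * k)))"
  have u_Suc: "u (Suc k) = u k ^ (p ^ d)" for k
    by (simp add: u_def add.commute flip: power_mult power_add)
  \<comment> \<open>Frobenius is additive, so each increment is a Frobenius power of the first
    one.\<close>
  have increment: "av (u (Suc k) - u k) = \<delta> ^ (p ^ (d * k))" for k
  proof -
    have "u (Suc k) - u k = (a ^ (p ^ d) - a) ^ (p ^ (d * k))"
      by (simp add: u_def frobenius_diff power_add flip: power_mult)
    then show ?thesis by (simp add: \<delta>_def)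
  qed
  have tail: "av (u n - u N) \<le> \<delta> ^ (p ^ (d * N))" if "N \<le> n" for n N
    using that
  proof (induction n rule: dec_induct)
    case (step n)
    have "\<delta> ^ (p ^ (d * n)) \<le> \<delta> ^ (p ^ (d * N))"
      using step.hyps \<delta> prime_gt_0_nat[OF prime_p] by (intro power_decreasing power_increasing) auto
    then have "av (u (Suc n) - u n) \<le> \<delta> ^ (p ^ (d * N))" using increment[of n] by simp
    then show ?case using step.IH by (rule av_diff_trans)
  qed (use \<delta> in simp)
  \<comment> \<open>A crude bound suffices: it compares the errors with the geometric sequence
    \<open>\<delta> ^ N\<close>.\<close>
  have exponent: "N \<le> p ^ (d * N)" for N
  proof -
    have "N < 2 ^ N" by simp
    also have "(2::nat) ^ N \<le> p ^ N" using prime_ge_2_nat[OF prime_p] by (intro power_mono) auto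
    also have "\<dots> \<le> p ^ (d * N)"
      using d(1) prime_gt_0_nat[OF prime_p] by (intro power_increasing) auto
    finally show ?thesis by simp
  qed
  have "av_cauchy av u"
    unfolding av_cauchy_def
  proof (intro allI impI)
    fix e :: real assume "0 < e"
    then obtain N where N: "\<delta> ^ N < e" using real_arch_pow_inv[of e \<delta>] \<delta> by auto
    have *: "\<delta> ^ (p ^ (d * N)) \<le> \<delta> ^ N"
      using exponent \<delta> by (intro power_decreasing) auto
    have "av (u m - u n) < e" if "N \<le> m" "N \<le> n" for m n
      using av_diff_trans[of "u m" "u N" "\<delta> ^ N" "u n"] tail[OF that(1)] tail[OF that(2)] * N
      by (simp add: av_minus_commute)
    then show "\<exists>N. \<forall>m\<ge>N. \<forall>n\<ge>N. av (u m - u n) < e" by blast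
  qed
  moreover have "u n \<in> K" for n using assms by (simp add: u_def K_power OK_def)
  ultimately obtain b where b: "b \<in> K" "av_lim av u b" using K_complete by blast
  \<comment> \<open>Frobenius does not increase distances below one, which is why \<open>e\<close>
    is capped by 1. Hence the shifted sequence \<open>u (Suc n)\<close> tends to
    \<open>b ^ (p ^ d)\<close> as well as to \<open>b\<close>.\<close>
  have "b ^ (p ^ d) = b"
  proof (rule eq_if_av_diff_le)
    fix e :: real assume "0 < e"
    then have "0 < min e 1" by simp
    then obtain N where N: "\<And>n. n \<ge> N \<Longrightarrow> av (u n - b) < min e 1"
      using b(2) unfolding av_lim_def by blast
    have "av (u (Suc N) - b ^ (p ^ d)) = av (u N - b) ^ (p ^ d)"
      by (simp add: u_Suc flip: frobenius_diff)
    also have "\<dots> \<le> av (u N - b) ^ 1"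
      using N[of N] prime_gt_0_nat[OF prime_p] by (intro power_decreasing) auto
    finally have "av (b ^ (p ^ d) - u (Suc N)) \<le> e" using N[of N] by (simp add: av_minus_commute)
    moreover have "av (u (Suc N) - b) \<le> e" using N[of "Suc N"] by simp
    ultimately show "av (b ^ (p ^ d) - b) \<le> e" by (rule av_diff_trans)
  qed
  then have "b \<in> Fbar" using d(1) by (auto simp: Fbar_def)
  moreover have "av (a - b) < 1"
  proof -
    obtain N where "av (u N - b) < 1" using b(2) unfolding av_lim_def by (metis order_refl zero_less_one)
    moreover have "av (a - u N) < 1"
      using tail[of 0 N] \<delta> by (simp add: u_def av_minus_commute)
    ultimately show ?thesis using av_add_lessI[of "a - u N" 1 "u N - b"] by simp
  qed
  ultimately show thesis using that b(1) by blast
qed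

text \<open>Reduction maps the constants \<open>K \<inter> Fbar\<close> bijectively onto the residue
  field: injective because nonzero elements of \<open>Fbar\<close> have absolute value one,
  surjective by \<open>teichmueller\<close>.\<close>

lemma
  shows finite_constants: "finite (K \<inter> Fbar)"
    and card_constants: "card (K \<inter> Fbar) = q"
proof -
  have OK: "K \<inter> Fbar \<subseteq> OK" using Fbar_av by (fastforce simp: OK_def)
  have "bij_betw (\<lambda>b. residue_rel `` {b}) (K \<inter> Fbar) (OK // residue_rel)"
    unfolding bij_betw_def
  proof (intro conjI equalityI subsetI)
    show "inj_on (\<lambda>b. residue_rel `` {b}) (K \<inter> Fbar)"
    proof (rule inj_onI)
      fix b c assume bc: "b \<in> K \<inter> Fbar" "c \<in> K \<inter> Fbar" "residue_rel `` {b} = residue_rel `` {c}"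
      then have "(b, c) \<in> residue_rel" using OK eq_equiv_class[OF bc(3) equiv_residue] by blast
      then have "av (b - c) < 1" by (simp add: residue_rel_def)
      moreover have "b - c \<in> Fbar" using bc Fbar_diff by blast
      ultimately show "b = c" using Fbar_av[of "b - c"] by fastforce
    qed
  next
    fix A assume "A \<in> OK // residue_rel"
    then obtain a where a: "a \<in> OK" "A = residue_rel `` {a}" by (rule quotientE)
    then obtain b where b: "b \<in> K" "b \<in> Fbar" "av (a - b) < 1" using teichmueller by blast
    then have "(a, b) \<in> residue_rel" using a OK by (auto simp: residue_rel_def)
    then have "A = residue_rel `` {b}" using a(2) equiv_class_eq[OF equiv_residue] by blast
    then show "A \<in> (\<lambda>b. residue_rel `` {b}) ` (K \<inter> Fbar)" using b by blast
  next
    fix A assume "A \<in> (\<lambda>b. residue_rel `` {b}) ` (K \<inter> Fbar)"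
    then obtain b where "b \<in> OK" "A = residue_rel `` {b}" using OK by blast
    then show "A \<in> OK // residue_rel" by (simp add: quotientI)
  qed
  then show "finite (K \<inter> Fbar)" "card (K \<inter> Fbar) = q"
    using finite_residue card_residue bij_betw_finite bij_betw_same_card by metis+
qed

section \<open>The \<open>q\<close>-power map on constants and its additivity\<close>

lemma q_ge_2: "2 \<le> q"
  using card_mono[OF finite_constants, of "{0, 1}"] by (simp add: card_constants)

text \<open>Fermat's argument: multiplication by \<open>b\<close> permutes the \<open>q - 1\<close>
  nonzero constants, so comparing their products gives \<open>b ^ (q - 1) = 1\<close>.\<close>

lemma constants_power_q:
  assumes "b \<in> K \<inter> Fbar"
  shows "b ^ q = b"
proof (cases "b = 0")
  case True
  then show ?thesis using q_ge_2 by simp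
next
  case False
  let ?F = "K \<inter> Fbar - {0}"
  have fin: "finite ?F" using finite_constants by simp
  have inj: "inj_on (\<lambda>y. b * y) ?F" using False by (auto intro: inj_onI)
  moreover have "(\<lambda>y. b * y) ` ?F \<subseteq> ?F" using assms False by (auto intro: K_mult Fbar_mult)
  ultimately have im: "(\<lambda>y. b * y) ` ?F = ?F" using endo_inj_surj[OF fin] by blast
  have "(\<Prod>y\<in>?F. y) = (\<Prod>y\<in>?F. b * y)"
    by (subst (1) im[symmetric]) (simp add: prod.reindex[OF inj])
  also have "\<dots> = b ^ card ?F * (\<Prod>y\<in>?F. y)" by (simp add: prod.distrib)
  finally have "b ^ card ?F = 1" using fin by simp
  moreover have "card ?F = q - 1" using finite_constants by (simp add: card_constants)
  ultimately show ?thesis using power_minus_mult[of q b] q_ge_2 by simp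
qed

text \<open>The polynomial \<open>(X + 1) ^ q - X ^ q - 1\<close> has degree below \<open>q\<close> and vanishes on the
  \<open>q\<close> constants, so it is zero. This avoids showing that \<open>q\<close> is a power of \<open>p\<close>.\<close>

lemma q_frobenius_add: "(x + y :: 'a) ^ q = x ^ q + y ^ q"
proof -
  define P :: "'a poly" where "P = [:1, 1:] ^ q - monom 1 q - 1"
  have "P = 0"
  proof (rule ccontr)
    assume "P \<noteq> 0"
    have "coeff ([:1, 1:] ^ q :: 'a poly) q = 1"
      using lead_coeff_power[of "[:1, 1:] :: 'a poly" q] by (simp add: degree_linear_power)
    then have "coeff P q = 0" using q_ge_2 by (simp add: P_def)
    moreover have "degree P \<le> q"
      unfolding P_def by (intro degree_diff_le) (simp_all add: degree_linear_power degree_monom_le)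
    ultimately have "degree P < q"
      using \<open>P \<noteq> 0\<close> by (metis le_neq_implies_less leading_coeff_0_iff)
    moreover have "K \<inter> Fbar \<subseteq> {x. poly P x = 0}"
    proof
      fix x assume x: "x \<in> K \<inter> Fbar"
      then have "(1 + x) ^ q = 1 + x" by (intro constants_power_q) (auto intro: K_add Fbar_add)
      then show "x \<in> {x. poly P x = 0}" using constants_power_q[OF x] by (simp add: P_def poly_monom)
    qed
    ultimately show False
      using card_mono[OF poly_roots_finite[OF \<open>P \<noteq> 0\<close>], of "K \<inter> Fbar"]
        card_poly_roots_bound[OF \<open>P \<noteq> 0\<close>] card_constants by linarith
  qed
  have *: "(1 + z) ^ q = z ^ q + 1" for z :: 'a
  proof -
    have "poly P z = 0" using \<open>P = 0\<close> by simp
    then show ?thesis by (simp add: P_def poly_monom algebra_simps)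
  qed
  show ?thesis
  proof (cases "y = 0")
    case True
    then show ?thesis using q_ge_2 by simp
  next
    case False
    \<comment> \<open>Homogenise the one-variable identity at \<open>x / y\<close>.\<close>
    then have "x + y = y * (1 + x / y)" by (simp add: field_simps)
    then have "(x + y) ^ q = (y * (1 + x / y)) ^ q" by (rule arg_cong)
    also have "\<dots> = x ^ q + y ^ q"
      unfolding power_mult_distrib * using False by (simp add: field_simps power_divide)
    finally show ?thesis .
  qed
qed

lemma q_frobenius_diff: "(x - y :: 'a) ^ q = x ^ q - y ^ q"
  using q_frobenius_add[of "x - y" y] by simp

lemma q_frobenius_sum: "(sum g I :: 'a) ^ q = (\<Sum>i\<in>I. g i ^ q)"
  by (induction I rule: infinite_finite_induct) (use q_ge_2 in \<open>auto simp: q_frobenius_add\<close>)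

text \<open>The detour through roots of unity avoids relating \<open>q\<close> to a power of
  \<open>p\<close>.\<close>

lemma power_q_fixed_Fbar: "(b :: 'a) ^ q = b \<Longrightarrow> b \<in> Fbar"
  using root_of_unity_if_power_eq_self[of b q] roots_of_unity_Fbar q_ge_2 by (cases "b = 0") auto

text \<open>Frobenius on the maximal unramified extension of \<open>K\<close> is an isometry. Subtracting the
  Teichmueller representatives of the leading coefficients, whose combination vanishes because it
  is an element of \<open>Fbar\<close> of absolute value below one, makes all coefficients smaller.\<close>

lemma frobenius_isometry:
  fixes I :: "'i set" and \<omega> :: "'i \<Rightarrow> 'a"
  assumes t: "t \<in> K" "0 < av t" "av t < 1" "\<And>x. x \<in> K \<Longrightarrow> av x < 1 \<Longrightarrow> av x \<le> av t"
    and \<omega>: "\<And>i. i \<in> I \<Longrightarrow> \<omega> i \<in> roots_of_unity"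
    and T: "T \<in> K" "T \<noteq> 0"
    and a: "\<And>i. i \<in> I \<Longrightarrow> a i \<in> K" "\<And>i. i \<in> I \<Longrightarrow> av (a i) \<le> av T"
    and small: "av (\<Sum>i\<in>I. a i * \<omega> i) \<le> av T * av t ^ m"
  shows "av (\<Sum>i\<in>I. a i * \<omega> i ^ q) \<le> av T * av t ^ m"
  using T a small
\<comment> \<open>\<open>T\<close> is the scale of the coefficients and \<open>m\<close> the extra
  precision. Each step passes from scale \<open>T\<close> to scale \<open>T * t\<close> and lowers
  \<open>m\<close> by one.\<close>
proof (induction m arbitrary: T a)
  case 0
  then show ?case using \<omega> by (intro av_sum_leI) (auto simp: av_eq_1_if_root_of_unity)
next
  case (Suc m)
  have "\<forall>i\<in>I. \<exists>b. b \<in> K \<and> b \<in> Fbar \<and> av (a i / T - b) < 1"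
  proof
    fix i assume i: "i \<in> I"
    have "av (a i / T) \<le> 1"
      using Suc.prems(2,4) i by (simp add: divide_inverse) (simp add: field_simps)
    then have "a i / T \<in> OK" using Suc.prems i by (auto simp: OK_def K_divide)
    then show "\<exists>b. b \<in> K \<and> b \<in> Fbar \<and> av (a i / T - b) < 1" using teichmueller by blast
  qed
  then obtain b where b: "\<And>i. i \<in> I \<Longrightarrow> b i \<in> K" "\<And>i. i \<in> I \<Longrightarrow> b i \<in> Fbar"
      "\<And>i. i \<in> I \<Longrightarrow> av (a i / T - b i) < 1"
    by metis
  \<comment> \<open>The remainder after removing the Teichmueller digit \<open>b i\<close> of
    \<open>a i / T\<close>; discreteness of the valuation makes it at most
    \<open>av (T * t)\<close>.\<close>
  define a' where "a' = (\<lambda>i. a i - T * b i)"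
  have a': "a' i \<in> K" "av (a' i) \<le> av (T * t)" if "i \<in> I" for i
  proof -
    show "a' i \<in> K" using that Suc.prems b by (auto simp: a'_def intro!: K_diff K_mult)
    have "a' i = T * (a i / T - b i)" using Suc.prems(2) by (simp add: a'_def field_simps)
    moreover have "av (a i / T - b i) \<le> av t"
      using that Suc.prems b by (intro t(4) K_diff K_divide) auto
    ultimately show "av (a' i) \<le> av (T * t)" by (simp add: mult_left_mono)
  qed
  let ?B = "\<Sum>i\<in>I. b i * \<omega> i"
  have "?B = 0"
  proof (rule ccontr)
    assume "?B \<noteq> 0"
    moreover have "?B \<in> Fbar" using b \<omega> by (intro Fbar_sum Fbar_mult) (auto intro: roots_of_unity_Fbar)
    ultimately have "av ?B = 1" using Fbar_av by blast
    have "av (\<Sum>i\<in>I. a' i * \<omega> i) \<le> av T * av t"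
      using a' \<omega> t(2) by (intro av_sum_leI) (auto simp: av_eq_1_if_root_of_unity)
    moreover have "av (\<Sum>i\<in>I. a i * \<omega> i) \<le> av T * av t"
    proof -
      have "av T * av t ^ Suc m \<le> av T * av t ^ 1"
        using t by (intro mult_left_mono power_decreasing) auto
      then show ?thesis using Suc.prems(5) by simp
    qed
    ultimately have "av ((\<Sum>i\<in>I. a i * \<omega> i) - (\<Sum>i\<in>I. a' i * \<omega> i)) \<le> av T * av t"
      by (rule av_diff_leI[rotated])
    moreover have "(\<Sum>i\<in>I. a i * \<omega> i) - (\<Sum>i\<in>I. a' i * \<omega> i) = T * ?B"
      by (simp add: a'_def sum_distrib_left algebra_simps flip: sum_subtractf)
    ultimately have "av T * 1 \<le> av T * av t" using \<open>av ?B = 1\<close> by simp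
    then show False using t(3) Suc.prems(2) by simp
  qed
  have "(\<Sum>i\<in>I. a i * \<omega> i) = (\<Sum>i\<in>I. a' i * \<omega> i) + T * ?B"
    by (simp add: a'_def sum_distrib_left algebra_simps flip: sum.distrib)
  then have "av (\<Sum>i\<in>I. a' i * \<omega> i) \<le> av (T * t) * av t ^ m"
    using Suc.prems(5) \<open>?B = 0\<close> by (simp add: ac_simps)
  then have IH: "av (\<Sum>i\<in>I. a' i * \<omega> i ^ q) \<le> av (T * t) * av t ^ m"
    using Suc.prems t a' by (intro Suc.IH) (auto intro: K_mult)
  \<comment> \<open>The digits are fixed by the \<open>q\<close>-power map, so their combination
    with \<open>\<omega> i ^ q\<close> is \<open>?B ^ q = 0\<close> and the removed part disappears
    on both sides.\<close>
  have "(\<Sum>i\<in>I. b i * \<omega> i ^ q) = (\<Sum>i\<in>I. (b i * \<omega> i) ^ q)"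
    using b by (intro sum.cong) (simp_all add: power_mult_distrib constants_power_q)
  also have "\<dots> = ?B ^ q" by (rule q_frobenius_sum[symmetric])
  also have "\<dots> = 0" using \<open>?B = 0\<close> q_ge_2 by simp
  finally have "(\<Sum>i\<in>I. a i * \<omega> i ^ q) = (\<Sum>i\<in>I. a' i * \<omega> i ^ q)"
    by (simp add: a'_def left_diff_distrib sum_subtractf mult.assoc flip: sum_distrib_left)
  then show ?case using IH by (simp add: ac_simps)
qed

section \<open>Frobenius applied to a value of the series\<close>

lemma roots_of_unity_powi:
  assumes "x \<in> roots_of_unity"
  shows "(x :: 'a) powi k \<in> roots_of_unity"
proof -
  obtain n where n: "n > 0" "x ^ n = 1" using assms by (auto simp: roots_of_unity_def)
  have "(x powi k) ^ n = (x ^ n) powi k"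
    by (simp flip: power_int_of_nat power_int_mult add: mult.commute)
  then show ?thesis using n by (auto simp: roots_of_unity_def)
qed

text \<open>Truncate the relation \<open>f(\<zeta>) - \<eta> = 0\<close> to a finite combination of
  roots of unity over \<open>K\<close>. It is small, and \<open>frobenius_isometry\<close> keeps it
  equally small after raising the roots of unity to the power \<open>q\<close>. That
  \<open>\<eta>\<close> is itself a root of unity lets it enter as one more term.\<close>

lemma ls_eval_frobenius:
  assumes f: "f \<in> A11 av K" and \<zeta>: "\<zeta> \<in> roots_of_unity" and \<eta>: "ls_eval av f \<zeta> \<in> roots_of_unity"
  shows "ls_eval av f (\<zeta> ^ q) = ls_eval av f \<zeta> ^ q"
proof -
  obtain t where t: "t \<in> K" "0 < av t" "av t < 1" "\<And>x. x \<in> K \<Longrightarrow> av x < 1 \<Longrightarrow> av x \<le> av t"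
    using uniformizer by blast
  have f': "null f" "\<And>n. f n \<in> K" using f by (auto simp: A11_def)
  obtain B where B: "1 \<le> B" "\<And>n. av (f n) \<le> B" using null_bound[OF f'(1)] by blast
  obtain N where N: "B < inverse (av t) ^ N"
    using real_arch_pow[of "inverse (av t)" B] t by (auto simp: one_less_inverse_iff)
  \<comment> \<open>A scale in \<open>K\<close> bounding all coefficients of \<open>f\<close>, and
    also the coefficient -1 of \<open>\<eta>\<close> because \<open>1 \<le> B\<close>.\<close>
  define T where "T = inverse t ^ N"
  have T: "T \<in> K" "T \<noteq> 0" "B \<le> av T" using t N by (auto simp: T_def K_power K_inverse)
  define \<eta> where "\<eta> = ls_eval av f \<zeta>"
  have \<zeta>q: "av (\<zeta> ^ q) = 1" "av \<zeta> = 1" using av_eq_1_if_root_of_unity[OF \<zeta>] by simp_all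
  have powi_q: "(\<zeta> powi n) ^ q = (\<zeta> ^ q) powi n" for n
    by (simp flip: power_int_of_nat power_int_mult add: mult.commute)
  have bound: "av (ls_eval av f (\<zeta> ^ q) - \<eta> ^ q) \<le> av T * av t ^ m" for m
  proof -
    let ?e = "av T * av t ^ m"
    have e: "0 < ?e" using T t by simp
    define F where "F = {n. ?e \<le> av (f n)}"
    have F: "finite F" "\<And>n. n \<notin> F \<Longrightarrow> av (f n) \<le> ?e"
      using null_finite[OF f'(1) e] by (auto simp: F_def)
    \<comment> \<open>The extra index on the right of the disjoint sum carries \<open>\<eta>\<close>
      with coefficient -1.\<close>
    define \<omega> where "\<omega> = case_sum (\<lambda>n. \<zeta> powi n) (\<lambda>_::unit. \<eta>)"
    define a where "a = case_sum f (\<lambda>_::unit. -1)"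
    let ?I = "F <+> (UNIV :: unit set)"
    have sum: "(\<Sum>i\<in>?I. a i * \<omega> i ^ k) = (\<Sum>n\<in>F. f n * (\<zeta> powi n) ^ k) - \<eta> ^ k" for k
      using F(1) by (simp add: sum.Plus a_def \<omega>_def)
    have approx: "av (ls_eval av f x - (\<Sum>n\<in>F. f n * x powi n)) \<le> ?e" if "av x = 1" for x
      unfolding ls_eval_def using F e that by (intro lsum_approx null_twist f') auto
    have "av (\<Sum>i\<in>?I. a i * \<omega> i ^ q) \<le> ?e"
    proof (rule frobenius_isometry[OF t])
      show "av (\<Sum>i\<in>?I. a i * \<omega> i) \<le> ?e"
        using sum[of 1] approx[OF \<zeta>q(2)] by (simp add: \<eta>_def av_minus_commute)
      have "-1 \<in> K" using K_diff[OF K_0 K_1] by simp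
      then show "a i \<in> K" if "i \<in> ?I" for i using f' by (auto simp: a_def split: sum.split)
      show "av (a i) \<le> av T" if "i \<in> ?I" for i
        using B T(3) by (auto simp: a_def split: sum.split intro: order_trans)
      show "\<omega> i \<in> roots_of_unity" if "i \<in> ?I" for i
        using roots_of_unity_powi[OF \<zeta>] \<eta> by (auto simp: \<omega>_def \<eta>_def split: sum.split)
    qed (use T in auto)
    then have "av ((\<Sum>n\<in>F. f n * (\<zeta> ^ q) powi n) - \<eta> ^ q) \<le> ?e" by (simp add: sum powi_q)
    with approx[OF \<zeta>q(1)] show ?thesis by (rule av_diff_trans)
  qed
  have "ls_eval av f (\<zeta> ^ q) = \<eta> ^ q"
  proof (rule eq_if_av_diff_le)
    fix e :: real assume "0 < e"
    then obtain m where m: "av t ^ m < e / av T"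
      using real_arch_pow_inv[of "e / av T" "av t"] t T by auto
    then have "av T * av t ^ m < e" using T by (simp add: field_simps)
    then show "av (ls_eval av f (\<zeta> ^ q) - \<eta> ^ q) \<le> e" using bound[of m] by linarith
  qed
  then show ?thesis by (simp add: \<eta>_def)
qed

section \<open>Comparison of \<open>f(X) ^ q\<close> with \<open>f(X ^ q)\<close>\<close>

lemma
  assumes "null s"
  shows null_subst_pow: "null (ls_subst_pow s q)"
    and ls_eval_subst_pow: "av x = 1 \<Longrightarrow> ls_eval av (ls_subst_pow s q) x = ls_eval av s (x ^ q)"
proof -
  have q: "0 < q" using q_ge_2 by simp
  show "null (ls_subst_pow s q)"
    unfolding ls_subst_pow_def using assms q by (rule null_dilate)
  assume x: "av x = 1"
  have "x powi (int q * k) = (x ^ q) powi k" for k by (simp add: power_int_mult)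
  then have "ls_subst_pow s q n * x powi n =
    (if int q dvd n then s (n div int q) * (x ^ q) powi (n div int q) else 0)" for n
    using q by (auto simp: ls_subst_pow_def elim!: dvdE)
  then show "ls_eval av (ls_subst_pow s q) x = ls_eval av s (x ^ q)"
    unfolding ls_eval_def using lsum_dilate[OF null_twist[OF assms, of "x ^ q"] q] x by simp
qed

text \<open>The \<open>q\<close>-power map is additive and does not enlarge elements of absolute
  value at most one, so it passes through infinite sums. The cap 1 in \<open>d\<close> ensures the
  latter.\<close>

lemma
  assumes "null s"
  shows null_power_q: "null (\<lambda>n. s n ^ q)"
    and lsum_power_q: "lsum av (\<lambda>n. s n ^ q) = lsum av s ^ q"
proof -
  have *: "\<exists>F. finite F \<and> (\<forall>n. n \<notin> F \<longrightarrow> av (s n ^ q) \<le> e) \<and>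
    av ((\<Sum>n\<in>F. s n ^ q) - lsum av s ^ q) \<le> e" if "0 < e" for e
  proof -
    define d where "d = min e 1"
    have d: "0 < d" "d \<le> e" "d \<le> 1" using that by (auto simp: d_def)
    have pow: "av (x ^ q) \<le> e" if "av x \<le> d" for x
    proof -
      have "av (x ^ q) \<le> av x ^ 1"
        unfolding av_power using that d q_ge_2 by (intro power_decreasing) auto
      then show ?thesis using that d by simp
    qed
    define F where "F = {n. d \<le> av (s n)}"
    have F: "finite F" "\<And>n. n \<notin> F \<Longrightarrow> av (s n) \<le> d"
      using null_finite[OF assms d(1)] by (auto simp: F_def)
    have "av (lsum av s - sum s F) \<le> d" using lsum_approx[OF assms F(1) d(1) F(2)] .
    then have "av ((sum s F - lsum av s) ^ q) \<le> e" by (intro pow) (simp add: av_minus_commute)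
    then have "av ((\<Sum>n\<in>F. s n ^ q) - lsum av s ^ q) \<le> e"
      by (simp only: q_frobenius_diff q_frobenius_sum)
    then show ?thesis using F pow by blast
  qed
  show "null (\<lambda>n. s n ^ q)" by (rule nullI) (use * in blast)
  then show "lsum av (\<lambda>n. s n ^ q) = lsum av s ^ q" using * by (rule lsum_eqI)
qed

text \<open>Fixed coefficients have absolute value 0 or 1, so convergence to zero leaves finitely
  many nonzero ones; they are roots of \<open>X ^ q - X\<close>.\<close>

lemma special_if_power_q_fixed:
  assumes "null f" "\<And>n. f n ^ q = f n"
  shows "special f"
proof -
  have "{n. f n \<noteq> 0} \<subseteq> {n. 1 \<le> av (f n)}"
    using Fbar_av power_q_fixed_Fbar assms(2) by auto
  then have "finite {n. f n \<noteq> 0}" using null_finite[OF assms(1), of 1] finite_subset by auto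
  moreover have "f n \<in> alg_prime_field" for n
  proof -
    define P :: "'a poly" where "P = monom 1 q - monom 1 1"
    have "coeff P i = of_int ((if i = q then 1 else 0) - (if i = 1 then 1 else 0))" for i
      by (simp add: P_def)
    then have "coeff P i \<in> range of_int" for i by (metis rangeI)
    moreover have "coeff P q = 1" using q_ge_2 by (simp add: P_def)
    then have "P \<noteq> 0" by auto
    moreover have "poly P (f n) = 0" using assms(2) by (simp add: P_def poly_monom)
    ultimately show ?thesis by (auto simp: alg_prime_field_def)
  qed
  ultimately show ?thesis by (simp add: special_def)
qed

text \<open>Evaluation on the unit circle identifies \<open>f ^ q - f(X ^ q)\<close> with the series with
  coefficients \<open>f n ^ q - f n\<close> in degrees \<open>q * n\<close>.\<close>

lemma pow_diff_subst_nonzero: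
  assumes f: "null f" "\<not> special f"
  obtains n where "ls_pow av f q n - ls_subst_pow f q n \<noteq> 0"
proof -
  let ?D = "\<lambda>n. f n ^ q - f n"
  obtain k where k: "?D k \<noteq> 0" using special_if_power_q_fixed[OF f(1)] f(2) by auto
  have D: "null ?D" using f(1) by (intro null_diff null_power_q)
  have G: "null (\<lambda>n. ls_pow av f q n - ls_subst_pow f q n)"
    using f(1) by (intro null_diff null_ls_pow null_subst_pow)
  obtain t where t: "0 < av t" "av t < 1" using uniformizer by blast
  have "(\<lambda>n. ls_pow av f q n - ls_subst_pow f q n) = ls_subst_pow ?D q"
  proof (rule ls_eqI[OF G null_subst_pow[OF D] infinite_unit_circle[OF t]])
    fix x assume x: "av x = 1"
    have xq: "av (x ^ q) = 1" using x by simp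
    \<comment> \<open>Termwise \<open>q\<close>-th powers write \<open>f(x) ^ q\<close> as the value
      at \<open>x ^ q\<close> of the series with coefficients \<open>f n ^ q\<close>.\<close>
    have "(f n * x powi n) ^ q = f n ^ q * (x ^ q) powi n" for n
    proof -
      have "(x powi n) ^ q = (x ^ q) powi n"
        by (simp flip: power_int_of_nat power_int_mult add: mult.commute)
      then show ?thesis by (simp add: power_mult_distrib)
    qed
    then have "ls_eval av (\<lambda>n. f n ^ q) (x ^ q) = ls_eval av f x ^ q"
      unfolding ls_eval_def using lsum_power_q[OF null_twist[OF f(1) x]] by simp
    then show "ls_eval av (\<lambda>n. ls_pow av f q n - ls_subst_pow f q n) x =
        ls_eval av (ls_subst_pow ?D q) x"
      using f(1) x xq D
      by (simp add: ls_eval_diff ls_eval_pow ls_eval_subst_pow null_power_q null_ls_pow null_subst_pow)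
  qed
  then have "ls_pow av f q (int q * k) - ls_subst_pow f q (int q * k) = ?D k"
    using q_ge_2 by (auto simp: ls_subst_pow_def dest!: fun_cong[of _ _ "int q * k"])
  then show thesis using k that[of "int q * k"] by simp
qed

end

theorem mainTheorem9:
  fixes av :: "'a::field \<Rightarrow> real" and K :: "'a set" and p q :: nat and f :: "int \<Rightarrow> 'a"
  assumes "nonarch_abs av"
    and "local_field_char_p av K p q"
    and "is_Omega av K"
    and "f \<in> A11 av K"
    and "\<not> special f"
  shows "finite {\<zeta> \<in> roots_of_unity. ls_eval av f \<zeta> \<in> roots_of_unity} \<and>
         card {\<zeta> \<in> roots_of_unity. ls_eval av f \<zeta> \<in> roots_of_unity}
           \<le> unit_zero_count av (\<lambda>n. ls_pow av f q n - ls_subst_pow f q n)"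
proof -
  interpret char_p_local_field av K p q
    using assms(1-3) by unfold_locales (auto simp: is_Omega_def)
  define g where "g = (\<lambda>n. ls_pow av f q n - ls_subst_pow f q n)"
  have f: "null f" using assms(4) by (simp add: A11_def)
  have g: "null g" unfolding g_def using f by (intro null_diff null_ls_pow null_subst_pow)
  obtain k where "g k \<noteq> 0" unfolding g_def using pow_diff_subst_nonzero[OF f assms(5)] by blast
  then obtain r a b where pr: "profile g r a b" using profile_exists[OF g] by blast
  obtain t where t: "0 < av t" "av t < 1" using uniformizer by blast
  let ?S = "{\<zeta> \<in> roots_of_unity. ls_eval av f \<zeta> \<in> roots_of_unity}"
  let ?Z = "{z. av z = 1 \<and> ls_eval av g z = 0}"
  \<comment> \<open>Over an infinite index set the sum in \<open>unit_zero_count\<close> would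
    default to zero, so finiteness is needed for the count itself and not only for
    \<open>card_mono\<close>.\<close>
  have fin: "finite ?Z" using finite_unit_zeros[OF g pr] .
  have sub: "?S \<subseteq> ?Z"
  proof clarify
    fix \<zeta> assume \<zeta>: "\<zeta> \<in> roots_of_unity" "ls_eval av f \<zeta> \<in> roots_of_unity"
    then have "av \<zeta> = 1" by (intro av_eq_1_if_root_of_unity)
    then show "av \<zeta> = 1 \<and> ls_eval av g \<zeta> = 0"
      unfolding g_def using f ls_eval_frobenius[OF assms(4) \<zeta>]
      by (simp add: ls_eval_diff ls_eval_pow ls_eval_subst_pow null_ls_pow null_subst_pow)
  qed
  have "card ?S \<le> card ?Z" using fin sub by (rule card_mono)
  also have "card ?Z \<le> (\<Sum>z\<in>?Z. zero_mult av g z)"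
    unfolding card_eq_sum
    using zero_mult_pos[OF g pr _ _ infinite_unit_circle[OF t]] by (intro sum_mono) auto
  finally show ?thesis
    using finite_subset[OF sub fin] by (simp add: unit_zero_count_def g_def)
qed

end
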